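(* Let $G$ be a finite group and let $S$ be an arbitrary subset of $N(G)$. Then for every normal subgroup $N\in A(S)$ and every $g\in G$, $$\chi^{N^\bullet}(g)=\begin{cases}\displaystyle\sum_{\psi\in\mathcal{X}^{N^\bullet}}\psi(1)^2 & \text{if } g\in N,\\[2ex] \displaystyle-\sum_{\substack{K\in A(S):\\ N\subset K}}\chi^{K^\bullet}(g) & \text{if } g\notin N.\end{cases}$$
   Context: $N(G)$ denotes the set of all normal subgroups of the finite group $G$; it is a semigroup under the product of subgroups. For $S\subseteq N(G)$, $A(S)$ is the smallest subsemigroup of $N(G)$ (i.e. closed under products $NH$) such that $\{1\},G\in A(S)$, $S\subseteq A(S)$, and $A(S)$ is closed under intersection. The symbol $\subset$ denotes strict inclusion. $\mathrm{Irr}(G)$ is the set of irreducible complex characters of $G$ and $\ker\psi=\{g\in G:\psi(g)=\psi(1)\}$. For $N\in A(S)$: $\mathcal{X}^N:=\{\psi\in\mathrm{Irr}(G): N\subseteq\ker\psi\}$; $\mathcal{X}^{N^\bullet}:=\mathcal{X}^N\setminus\bigcup_{K\in A(S),\,N\subset K}\mathcal{X}^K$; $\chi^{N^\bullet}:=\sum_{\psi\in\mathcal{X}^{N^\bullet}}\psi(1)\psi$ (equal to $0$ if $\mathcal{X}^{N^\bullet}=\emptyset$). *)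

theory Defs
  imports
    "HOL-Algebra.Coset"
    "Jordan_Normal_Form.VS_Connect"
    "HOL.Complex"
begin

(* GL_n(C), with the matrix product as multiplication. *)
abbreviation GLC :: "nat \<Rightarrow> complex mat monoid" where
  "GLC n \<equiv> units_of (ring_mat TYPE(complex) n ())"

definition mat_trace :: "complex mat \<Rightarrow> complex" where
  "mat_trace A = (\<Sum>i<dim_row A. A $$ (i, i))"

definition invariant_subspace ::
    "('a, 'b) monoid_scheme \<Rightarrow> nat \<Rightarrow> ('a \<Rightarrow> complex mat) \<Rightarrow> complex vec set \<Rightarrow> bool" where
  "invariant_subspace G n \<rho> W \<longleftrightarrow>
     subspace class_ring W (module_vec TYPE(complex) n) \<and>
     (\<forall>g\<in>carrier G. \<forall>w\<in>W. \<rho> g *\<^sub>v w \<in> W)"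

definition irreducible_rep ::
    "('a, 'b) monoid_scheme \<Rightarrow> nat \<Rightarrow> ('a \<Rightarrow> complex mat) \<Rightarrow> bool" where
  "irreducible_rep G n \<rho> \<longleftrightarrow>
     \<rho> \<in> hom G (GLC n) \<and> n > 0 \<and>
     (\<forall>W. invariant_subspace G n \<rho> W \<longrightarrow> W = {0\<^sub>v n} \<or> W = carrier_vec n)"

(* Characters are functions on carrier G; they are made undefined elsewhere, so that equality of
   elements of Irr G is equality of class functions on G. *)
definition Irr :: "('a, 'b) monoid_scheme \<Rightarrow> ('a \<Rightarrow> complex) set" where
  "Irr G = {\<lambda>g\<in>carrier G. mat_trace (\<rho> g) | n \<rho>. irreducible_rep G n \<rho>}"

definition char_ker :: "('a, 'b) monoid_scheme \<Rightarrow> ('a \<Rightarrow> complex) \<Rightarrow> 'a set" where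
  "char_ker G \<psi> = {g \<in> carrier G. \<psi> g = \<psi> \<one>\<^bsub>G\<^esub>}"

definition normal_subgroups :: "('a, 'b) monoid_scheme \<Rightarrow> 'a set set" where
  "normal_subgroups G = {N. N \<lhd> G}"

(* Products and intersections of normal subgroups are normal, so for S a set of normal subgroups
   AS G S consists of normal subgroups and is the smallest subsemigroup of N(G) that contains
   {1}, G and S and is closed under intersection. *)
inductive_set AS :: "('a, 'b) monoid_scheme \<Rightarrow> 'a set set \<Rightarrow> 'a set set"
  for G :: "('a, 'b) monoid_scheme" and S :: "'a set set" where
  AS_trivial: "{\<one>\<^bsub>G\<^esub>} \<in> AS G S"
| AS_carrier: "carrier G \<in> AS G S"
| AS_base: "N \<in> S \<Longrightarrow> N \<in> AS G S"
| AS_prod: "N \<in> AS G S \<Longrightarrow> H \<in> AS G S \<Longrightarrow> N <#>\<^bsub>G\<^esub> H \<in> AS G S"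
| AS_inter: "N \<in> AS G S \<Longrightarrow> H \<in> AS G S \<Longrightarrow> N \<inter> H \<in> AS G S"

definition X_ker :: "('a, 'b) monoid_scheme \<Rightarrow> 'a set \<Rightarrow> ('a \<Rightarrow> complex) set" where
  "X_ker G N = {\<psi> \<in> Irr G. N \<subseteq> char_ker G \<psi>}"

definition X_bullet ::
    "('a, 'b) monoid_scheme \<Rightarrow> 'a set set \<Rightarrow> 'a set \<Rightarrow> ('a \<Rightarrow> complex) set" where
  "X_bullet G S N = X_ker G N - (\<Union>K\<in>{K \<in> AS G S. N \<subset> K}. X_ker G K)"

(* For finite G the set Irr G is finite, so this sum does not hit the convention that sums over
   infinite sets are 0. *)
definition chi_bullet ::
    "('a, 'b) monoid_scheme \<Rightarrow> 'a set set \<Rightarrow> 'a set \<Rightarrow> 'a \<Rightarrow> complex" where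
  "chi_bullet G S N g = (\<Sum>\<psi>\<in>X_bullet G S N. \<psi> \<one>\<^bsub>G\<^esub> * \<psi> g)"

end

theory Submission
  imports Defs "Jordan_Normal_Form.Spectral_Radius" "HOL-Algebra.SndIsomorphismGrp"
begin

text \<open>
  For \<open>g \<in> N\<close> every character in \<open>X_ker G N\<close> takes the same value at \<open>g\<close> and at the identity.
  For \<open>g \<notin> N\<close>, the sum of \<open>\<psi>(1) \<psi>(g)\<close> over \<open>X_ker G N\<close> is the permutation character of \<open>G\<close> on
  \<open>G/N\<close>, which vanishes at \<open>g\<close>. Since \<open>AS G S\<close> is closed under products and the kernel of a character
  is a subgroup, each \<open>\<psi>\<close> has a largest \<open>K \<in> AS G S\<close> inside its kernel. So \<open>X_ker G N\<close> is the
  disjoint union of the sets \<open>X_bullet G S K\<close> with \<open>N \<subseteq> K\<close>, and the values \<open>chi_bullet G S K g\<close> over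
  these \<open>K\<close> add up to zero.

  Complete reducibility is not needed: only the trace of a representation matters, and it is the
  sum of the traces on the factors of a composition series. Multiplicities then come
  from Schur orthogonality.
\<close>

subsection \<open>Bases adapted to a subspace\<close>

lemma subspace_vecI:
  assumes "W \<subseteq> carrier_vec n" "0\<^sub>v n \<in> W"
    and "\<And>v w. v \<in> W \<Longrightarrow> w \<in> W \<Longrightarrow> v + w \<in> W" "\<And>c v. v \<in> W \<Longrightarrow> c \<cdot>\<^sub>v v \<in> W"
  shows "VectorSpace.subspace class_ring W (module_vec TYPE('a :: field) n)"
  unfolding VectorSpace.subspace_def submodule_def
  using assms vec_vs vec_module by (auto simp: module_vec_simps class_ring_simps)

lemma subspace_vecD:
  assumes "VectorSpace.subspace class_ring W (module_vec TYPE('a :: field) n)"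
  shows "W \<subseteq> carrier_vec n" "0\<^sub>v n \<in> W"
    and "\<And>v w. v \<in> W \<Longrightarrow> w \<in> W \<Longrightarrow> v + w \<in> W" "\<And>c v. v \<in> W \<Longrightarrow> c \<cdot>\<^sub>v v \<in> W"
  using assms unfolding VectorSpace.subspace_def submodule_def
  by (auto simp: module_vec_simps class_ring_simps)

text \<open>A square matrix with trivial kernel has nonzero determinant, hence is a unit of the
  matrix ring, and a unit has a two-sided inverse.\<close>

lemma inj_mat_inverse:
  fixes P :: "'a :: field mat"
  assumes P: "P \<in> carrier_mat n n"
    and inj: "\<And>v. v \<in> carrier_vec n \<Longrightarrow> P *\<^sub>v v = 0\<^sub>v n \<Longrightarrow> v = 0\<^sub>v n"
  obtains Q where "Q \<in> carrier_mat n n" "P * Q = 1\<^sub>m n" "Q * P = 1\<^sub>m n"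
proof -
  have "det P \<noteq> 0" using det_0_iff_vec_prod_zero[OF P] inj by blast
  then have "P \<in> Units (ring_mat TYPE('a) n ())" by (rule det_non_zero_imp_unit[OF P])
  then show ?thesis using that by (auto simp: Units_def ring_mat_simps)
qed

text \<open>A maximal independent subset \<open>A\<close> of \<open>W\<close> is extended to a
  maximal independent subset \<open>B\<close> of the whole space. The columns of \<open>P\<close>
  are the vectors of \<open>B\<close>, those of \<open>A\<close> first, so \<open>W\<close>
  corresponds to the vectors supported on the first \<open>k\<close> coordinates, where
  \<open>k\<close> is the size of \<open>A\<close>. This later brings an invariant subspace into
  block form.\<close>

lemma subspace_adapted_basis:
  fixes W :: "'a :: field vec set"
  assumes W: "VectorSpace.subspace class_ring W (module_vec TYPE('a) n)"
  obtains P Q k where "P \<in> carrier_mat n n" "Q \<in> carrier_mat n n" "P * Q = 1\<^sub>m n" "Q * P = 1\<^sub>m n"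
    "k \<le> n" "W = {P *\<^sub>v v | v. v \<in> carrier_vec n \<and> (\<forall>i. k \<le> i \<and> i < n \<longrightarrow> v $ i = 0)}"
proof -
  interpret V: vec_space "TYPE('a)" n .
  note WD = subspace_vecD[OF W]
  \<comment> \<open>The dimension bounds the size of independent sets; this bound makes both maximal
    sets below exist.\<close>
  have bound: "finite A \<and> card A \<le> n" if "A \<subseteq> carrier_vec n" "V.lin_indpt A" for A
    using that V.li_le_dim V.dim_is_n V.fin_dim by auto
  have "\<exists>A. finite A \<and> maximal A (\<lambda>A. A \<subseteq> W \<and> V.lin_indpt A)"
  proof (rule maximal_exists)
    show "finite A \<and> card A \<le> n" if "A \<subseteq> W \<and> V.lin_indpt A" for A
      using that bound WD(1) by blast
    show "{} \<subseteq> W \<and> V.lin_indpt {}" by (auto simp: V.lin_dep_def)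
  qed
  then obtain A where finA: "finite A" and mA: "maximal A (\<lambda>A. A \<subseteq> W \<and> V.lin_indpt A)"
    by blast
  from mA have A: "A \<subseteq> W" "V.lin_indpt A" by (simp_all add: maximal_def)
  have maxA: "B = A" if "A \<subseteq> B" "B \<subseteq> W" "V.lin_indpt B" for B
    using mA that by (simp add: maximal_def)
  have "\<exists>B. finite B \<and> maximal B (\<lambda>B. A \<subseteq> B \<and> B \<subseteq> carrier_vec n \<and> V.lin_indpt B)"
  proof (rule maximal_exists)
    show "finite B \<and> card B \<le> n" if "A \<subseteq> B \<and> B \<subseteq> carrier_vec n \<and> V.lin_indpt B" for B
      using that bound by blast
    show "A \<subseteq> A \<and> A \<subseteq> carrier_vec n \<and> V.lin_indpt A" using A WD(1) by auto
  qed
  then obtain B where finB: "finite B"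
    and mB: "maximal B (\<lambda>B. A \<subseteq> B \<and> B \<subseteq> carrier_vec n \<and> V.lin_indpt B)"
    by blast
  from mB have B: "A \<subseteq> B" "B \<subseteq> carrier_vec n" "V.lin_indpt B" by (simp_all add: maximal_def)
  have maxB: "C = B" if "B \<subseteq> C" "C \<subseteq> carrier_vec n" "V.lin_indpt C" for C
    using mB that B(1) by (auto simp: maximal_def)
  have "maximal B (\<lambda>S. S \<subseteq> carrier_vec n \<and> V.lin_indpt S)"
    unfolding maximal_def using B maxB by blast
  then have basB: "V.basis B" using V.max_li_is_basis by simp
  have cardB: "card B = n" using V.dim_basis[OF finB basB] V.dim_is_n by simp
  obtain as where as: "set as = A" "distinct as" using finite_distinct_list[OF finA] by blast
  obtain bs where bs: "set bs = B - A" "distinct bs" using finite_distinct_list[of "B - A"] finB by blast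
  \<comment> \<open>The order matters: the vectors of \<open>A\<close> occupy exactly the positions
    below \<open>length as\<close>.\<close>
  define ws where "ws = as @ bs"
  have ws: "distinct ws" "set ws = B" using as bs B(1) by (auto simp: ws_def)
  have len: "length ws = n" using distinct_card[OF ws(1)] ws(2) cardB by simp
  have dimws: "\<forall>w\<in>set ws. dim_vec w = n" using ws B(2) by auto
  define P where "P = mat_of_cols n ws"
  have P: "P \<in> carrier_mat n n" unfolding P_def using len by auto
  have Plin: "P *\<^sub>v vec n (\<lambda>i. f (ws ! i)) = V.lincomb f B" for f
  proof -
    have "V.lincomb f (set ws) = V.lincomb_list (\<lambda>i. f (ws ! i)) ws"
      using V.lincomb_as_lincomb_list_distinct ws B(2) by blast
    then show ?thesis
      using V.lincomb_list_as_mat_mult[OF dimws, of "\<lambda>i. f (ws ! i)"] ws(2) by (simp add: len P_def)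
  qed
  \<comment> \<open>\<open>V.lincomb\<close> takes coefficients indexed by vectors, while
    coordinates are indexed by positions; \<open>idx\<close> translates between the two.\<close>
  define idx where "idx = the_inv_into {..<n} (\<lambda>i. ws ! i)"
  have idx: "idx (ws ! i) = i" if "i < n" for i
    unfolding idx_def using that ws(1) len
    by (intro the_inv_into_f_f) (auto simp: inj_on_def nth_eq_iff_index_eq)
  have Plin': "P *\<^sub>v v = V.lincomb (\<lambda>w. v $ idx w) B" if "v \<in> carrier_vec n" for v
  proof -
    have "vec n (\<lambda>i. v $ idx (ws ! i)) = v" using that by (intro eq_vecI) (auto simp: idx)
    then show ?thesis using Plin[of "\<lambda>w. v $ idx w"] by simp
  qed
  have "v = 0\<^sub>v n" if v: "v \<in> carrier_vec n" "P *\<^sub>v v = 0\<^sub>v n" for v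
  proof -
    have 0: "V.lincomb (\<lambda>w. v $ idx w) B = 0\<^sub>v n" using Plin' v by simp
    have "v $ idx w = 0" if "w \<in> B" for w
      using B(3) 0 finB that unfolding V.lin_dep_def by blast
    then have "v $ i = 0" if "i < n" for i
      using idx[OF that] that ws(2) len nth_mem by metis
    then show ?thesis using v by (intro eq_vecI) auto
  qed
  then obtain Q where Q: "Q \<in> carrier_mat n n" "P * Q = 1\<^sub>m n" "Q * P = 1\<^sub>m n"
    using inj_mat_inverse[OF P] by blast
  have restrict: "V.lincomb f B = V.lincomb f A" if "\<And>w. w \<in> B - A \<Longrightarrow> f w = 0" for f
  proof (rule eq_vecI)
    have AC: "A \<subseteq> carrier_vec n" using A WD by blast
    show "dim_vec (V.lincomb f B) = dim_vec (V.lincomb f A)"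
      using V.lincomb_dim[OF finB B(2)] V.lincomb_dim[OF finA AC] by simp
    fix i assume "i < dim_vec (V.lincomb f A)"
    then have i: "i < n" using V.lincomb_dim[OF finA AC] by simp
    have "(\<Sum>w\<in>B. f w * w $ i) = (\<Sum>w\<in>A. f w * w $ i)"
      using finB B(1) that by (intro sum.mono_neutral_right) auto
    then show "V.lincomb f B $ i = V.lincomb f A $ i"
      using V.lincomb_index[OF i B(2)] V.lincomb_index[OF i AC] by simp
  qed
  have in_A: "ws ! i \<in> A \<longleftrightarrow> i < length as" if "i < n" for i
  proof
    assume "ws ! i \<in> A"
    then obtain j where "j < length as" "ws ! i = as ! j" using as by (metis in_set_conv_nth)
    then have "ws ! i = ws ! j" "j < n" using len by (auto simp: ws_def nth_append)
    then have "i = j" using ws(1) that len by (simp add: nth_eq_iff_index_eq)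
    then show "i < length as" using \<open>j < length as\<close> by simp
  next
    assume "i < length as"
    then show "ws ! i \<in> A" using as by (auto simp: ws_def nth_append)
  qed
  have spanA: "V.span A = W"
  proof
    show "V.span A \<subseteq> W" using W A V.span_is_subset V.is_module by blast
    show "W \<subseteq> V.span A"
    proof
      fix w assume w: "w \<in> W"
      have AC: "A \<subseteq> carrier_vec n" "w \<in> carrier_vec n" using A WD w by blast+
      show "w \<in> V.span A"
      proof (cases "w \<in> A")
        case True
        then show ?thesis using V.in_own_span[of A] AC by auto
      next
        case False
        \<comment> \<open>Adjoining \<open>w\<close> would contradict the maximality of
          \<open>A\<close> if the result were independent.\<close>
        then have "V.lin_dep (A \<union> {w})" using maxA[of "A \<union> {w}"] A w by auto
        then show ?thesis using V.lin_dep_iff_in_span[of A w] AC A False by simp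
      qed
    qed
  qed
  have "W = {P *\<^sub>v v | v. v \<in> carrier_vec n \<and> (\<forall>i. length as \<le> i \<and> i < n \<longrightarrow> v $ i = 0)}"
  proof (intro equalityI subsetI)
    fix w assume "w \<in> W"
    then obtain f where w: "w = V.lincomb f A"
      using spanA V.finite_span[of A] finA A WD(1) by auto
    \<comment> \<open>The values of \<open>f\<close> outside \<open>A\<close> are arbitrary. Setting
      them to zero makes the combinations over \<open>A\<close> and over \<open>B\<close>
      agree.\<close>
    define f' where "f' x = (if x \<in> A then f x else 0)" for x
    have "w = V.lincomb f' A" unfolding w f'_def
      using A WD(1) by (intro V.lincomb_cong) auto
    also have "\<dots> = P *\<^sub>v vec n (\<lambda>i. f' (ws ! i))"
      unfolding Plin by (rule restrict[symmetric]) (auto simp: f'_def)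
    finally show "w \<in> {P *\<^sub>v v | v. v \<in> carrier_vec n \<and> (\<forall>i. length as \<le> i \<and> i < n \<longrightarrow> v $ i = 0)}"
      by (intro CollectI exI[of _ "vec n (\<lambda>i. f' (ws ! i))"]) (auto simp: f'_def in_A)
  next
    fix w assume "w \<in> {P *\<^sub>v v | v. v \<in> carrier_vec n \<and> (\<forall>i. length as \<le> i \<and> i < n \<longrightarrow> v $ i = 0)}"
    then obtain v where v: "w = P *\<^sub>v v" "v \<in> carrier_vec n"
      "\<And>i. length as \<le> i \<Longrightarrow> i < n \<Longrightarrow> v $ i = 0" by auto
    have "v $ idx x = 0" if x: "x \<in> B - A" for x
    proof -
      obtain i where "i < n" "x = ws ! i" using x ws(2) len by (metis DiffD1 in_set_conv_nth)
      then show ?thesis using x in_A[of i] v(3)[of i] idx[of i] by simp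
    qed
    then have "w = V.lincomb (\<lambda>x. v $ idx x) A" using restrict Plin' v by metis
    then show "w \<in> W" using spanA V.finite_span[of A] finA A WD(1) by auto
  qed
  moreover have "length as \<le> n" using len by (simp add: ws_def)
  ultimately show ?thesis using that P Q by blast
qed

subsection \<open>Matrix representations and Schur's lemma\<close>

text \<open>An equational form of being a homomorphism into \<open>GLC n\<close>: over a group,
  invertibility of the images follows from the clauses on products and on the identity.\<close>

definition matrix_rep :: "('a, 'b) monoid_scheme \<Rightarrow> nat \<Rightarrow> ('a \<Rightarrow> complex mat) \<Rightarrow> bool" where
  "matrix_rep G n \<rho> \<longleftrightarrow> (\<forall>g\<in>carrier G. \<rho> g \<in> carrier_mat n n) \<and>
     (\<forall>g\<in>carrier G. \<forall>h\<in>carrier G. \<rho> (g \<otimes>\<^bsub>G\<^esub> h) = \<rho> g * \<rho> h) \<and> \<rho> \<one>\<^bsub>G\<^esub> = 1\<^sub>m n"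

text \<open>A homomorphism into the group of units preserves the identity. Conversely, the image of
  the inverse of \<open>g\<close> is an inverse matrix of \<open>\<rho> g\<close>.\<close>

lemma hom_GLC_iff_matrix_rep:
  assumes "group G"
  shows "\<rho> \<in> hom G (GLC n) \<longleftrightarrow> matrix_rep G n \<rho>"
proof -
  interpret group G by fact
  interpret R: ring "ring_mat TYPE(complex) n ()" by (rule ring_mat)
  have U: "carrier (GLC n) = Units (ring_mat TYPE(complex) n ())"
    "\<And>A B. A \<otimes>\<^bsub>GLC n\<^esub> B = A * B" "\<one>\<^bsub>GLC n\<^esub> = 1\<^sub>m n"
    by (simp_all add: units_of_def ring_mat_simps)
  show ?thesis
  proof
    assume h: "\<rho> \<in> hom G (GLC n)"
    interpret H: group_hom G "GLC n" \<rho>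
      using h R.units_group group_axioms by (simp add: group_hom_def group_hom_axioms_def)
    have "\<rho> g \<in> carrier_mat n n" if "g \<in> carrier G" for g
      using H.hom_closed[OF that] U R.Units_closed by (auto simp: ring_mat_simps)
    then show "matrix_rep G n \<rho>"
      unfolding matrix_rep_def using H.hom_mult H.hom_one U by simp
  next
    assume h: "matrix_rep G n \<rho>"
    have "\<rho> g \<in> Units (ring_mat TYPE(complex) n ())" if g: "g \<in> carrier G" for g
    proof -
      have "\<rho> (inv\<^bsub>G\<^esub> g) * \<rho> g = 1\<^sub>m n" "\<rho> g * \<rho> (inv\<^bsub>G\<^esub> g) = 1\<^sub>m n"
        using h g by (metis matrix_rep_def inv_closed l_inv r_inv)+
      then show ?thesis using h g unfolding Units_def ring_mat_simps matrix_rep_def by auto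
    qed
    then show "\<rho> \<in> hom G (GLC n)"
      using h unfolding hom_def U(1) by (auto simp: U matrix_rep_def)
  qed
qed

text \<open>Both sides are the same double sum in two orders. The factors may be rectangular, as is
  needed for an intertwiner between representations of possibly different degrees.\<close>

lemma mat_trace_mult_comm:
  assumes "A \<in> carrier_mat n m" "B \<in> carrier_mat m n"
  shows "mat_trace (A * B) = mat_trace (B * A)"
proof -
  have "mat_trace (A * B) = (\<Sum>i<n. \<Sum>j<m. A $$ (i,j) * B $$ (j,i))"
    using assms by (auto simp: mat_trace_def scalar_prod_def atLeast0LessThan intro!: sum.cong)
  also have "\<dots> = (\<Sum>j<m. \<Sum>i<n. B $$ (j,i) * A $$ (i,j))"
    by (subst sum.swap) (simp add: mult.commute)
  also have "\<dots> = mat_trace (B * A)"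
    using assms by (auto simp: mat_trace_def scalar_prod_def atLeast0LessThan intro!: sum.cong)
  finally show ?thesis .
qed

lemma mat_trace_one [simp]: "mat_trace (1\<^sub>m n) = of_nat n"
  by (simp add: mat_trace_def)

lemma index_mult_mat_sum:
  assumes "A \<in> carrier_mat n m" "B \<in> carrier_mat m k" "i < n" "j < k"
  shows "(A * B) $$ (i, j) = (\<Sum>l<m. A $$ (i, l) * B $$ (l, j))"
  using assms by (auto simp: scalar_prod_def atLeast0LessThan intro!: sum.cong)

lemma irreducible_repD:
  assumes "group G" "irreducible_rep G n \<rho>"
  shows "matrix_rep G n \<rho>" "n > 0"
    "\<And>W. invariant_subspace G n \<rho> W \<Longrightarrow> W = {0\<^sub>v n} \<or> W = carrier_vec n"
  using assms hom_GLC_iff_matrix_rep by (auto simp: irreducible_rep_def)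

text \<open>Schur's lemma. The kernel \<open>K\<close> of \<open>T\<close> is invariant under
  \<open>\<sigma>\<close> and its image \<open>I\<close> under \<open>\<rho>\<close>. By
  irreducibility either \<open>T\<close> vanishes, or \<open>K\<close> is zero and \<open>I\<close>
  is everything. In the second case an inverse is built directly, without first comparing
  \<open>n\<close> and \<open>m\<close>.\<close>

lemma intertwiner_zero_or_invertible:
  assumes G: "group G" and \<rho>: "irreducible_rep G n \<rho>" and \<sigma>: "irreducible_rep G m \<sigma>"
    and T: "T \<in> carrier_mat n m" and comm: "\<And>h. h \<in> carrier G \<Longrightarrow> \<rho> h * T = T * \<sigma> h"
  shows "T = 0\<^sub>m n m \<or> (\<exists>B\<in>carrier_mat m n. T * B = 1\<^sub>m n \<and> B * T = 1\<^sub>m m)"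
proof -
  note R = irreducible_repD[OF G \<rho>] and S = irreducible_repD[OF G \<sigma>]
  have Rc: "\<rho> h \<in> carrier_mat n n" and Sc: "\<sigma> h \<in> carrier_mat m m" if "h \<in> carrier G" for h
    using R(1) S(1) that by (auto simp: matrix_rep_def)
  define K where "K = {v \<in> carrier_vec m. T *\<^sub>v v = 0\<^sub>v n}"
  define I where "I = {T *\<^sub>v v | v. v \<in> carrier_vec m}"
  have act: "\<rho> h *\<^sub>v (T *\<^sub>v v) = T *\<^sub>v (\<sigma> h *\<^sub>v v)" if "h \<in> carrier G" "v \<in> carrier_vec m" for h v
    using comm[OF that(1)] Rc[OF that(1)] Sc[OF that(1)] T that(2)
    by (metis assoc_mult_mat_vec)
  have "invariant_subspace G m \<sigma> K" unfolding invariant_subspace_def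
  proof (intro conjI ballI)
    show "VectorSpace.subspace class_ring K (module_vec TYPE(complex) m)"
      using T by (intro subspace_vecI)
        (auto simp: K_def mult_add_distrib_mat_vec[OF T] mult_mat_vec[OF T])
    fix h v assume "h \<in> carrier G" "v \<in> K"
    moreover have "\<rho> h *\<^sub>v 0\<^sub>v n = 0\<^sub>v n" if "h \<in> carrier G"
      using Rc[OF that] by (intro eq_vecI) auto
    ultimately show "\<sigma> h *\<^sub>v v \<in> K" using act[of h v] Sc[of h] by (auto simp: K_def)
  qed
  then have K: "K = {0\<^sub>v m} \<or> K = carrier_vec m" by (rule S(3))
  have "invariant_subspace G n \<rho> I" unfolding invariant_subspace_def
  proof (intro conjI ballI)
    show "VectorSpace.subspace class_ring I (module_vec TYPE(complex) n)"
    proof (rule subspace_vecI)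
      show "I \<subseteq> carrier_vec n" using T by (auto simp: I_def)
      show "0\<^sub>v n \<in> I" unfolding I_def using T by (intro CollectI exI[of _ "0\<^sub>v m"]) auto
      show "v + w \<in> I" if "v \<in> I" "w \<in> I" for v w
        using that unfolding I_def by (auto simp: mult_add_distrib_mat_vec[OF T, symmetric])
      show "c \<cdot>\<^sub>v v \<in> I" if "v \<in> I" for c v
        using that unfolding I_def by (auto simp: mult_mat_vec[OF T, symmetric])
    qed
    fix h w assume h: "h \<in> carrier G" and "w \<in> I"
    then show "\<rho> h *\<^sub>v w \<in> I" using act[OF h] Sc[OF h] by (auto simp: I_def)
  qed
  then have I: "I = {0\<^sub>v n} \<or> I = carrier_vec n" by (rule R(3))
  have col: "T *\<^sub>v unit_vec m j = col T j" if "j < m" for j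
    using T that by (intro eq_vecI) auto
  have zero: "T = 0\<^sub>m n m" if "K = carrier_vec m \<or> I = {0\<^sub>v n}"
  proof (rule eq_matI)
    fix i j assume "i < dim_row (0\<^sub>m n m)" "j < dim_col (0\<^sub>m n m)"
    then have ij: "i < n" "j < m" by auto
    have "T *\<^sub>v unit_vec m j = 0\<^sub>v n" using that unfolding K_def I_def by (blast intro: unit_vec_carrier)
    then have "col T j $ i = 0" using col ij by simp
    then show "T $$ (i, j) = 0\<^sub>m n m $$ (i, j)" using T ij by auto
  qed (use T in auto)
  show ?thesis
  proof (cases "K = carrier_vec m \<or> I = {0\<^sub>v n}")
    case False
    then have K0: "K = {0\<^sub>v m}" and I1: "I = carrier_vec n" using K I by auto
    \<comment> \<open>By surjectivity the unit vectors have preimages; taken as columns they form a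
      right inverse of \<open>T\<close>.\<close>
    have "\<exists>b. b \<in> carrier_vec m \<and> T *\<^sub>v b = unit_vec n j" for j
    proof -
      have "unit_vec n j \<in> I" using I1 by simp
      then show ?thesis unfolding I_def by auto
    qed
    then obtain b where b: "\<And>j. b j \<in> carrier_vec m" "\<And>j. T *\<^sub>v b j = unit_vec n j" by metis
    define B where "B = mat_of_cols m (map b [0..<n])"
    have B: "B \<in> carrier_mat m n" unfolding B_def by auto
    have TB: "T * B = 1\<^sub>m n"
    proof (rule mat_col_eqI)
      fix j assume "j < dim_col (1\<^sub>m n)"
      then have j: "j < n" by simp
      have "col (T * B) j = T *\<^sub>v col B j" using T B j by (intro col_mult2) auto
      also have "col B j = b j" unfolding B_def using j b by (subst col_mat_of_cols) auto
      finally show "col (T * B) j = col (1\<^sub>m n) j" using b j by simp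
    qed (use T B in auto)
    \<comment> \<open>Injectivity turns the right inverse into a left inverse: \<open>T\<close> maps
      column \<open>j\<close> of \<open>B * T\<close> and the unit vector \<open>j\<close> to the
      same vector.\<close>
    have "B * T = 1\<^sub>m m"
    proof (rule mat_col_eqI)
      fix j assume "j < dim_col (1\<^sub>m m)"
      then have j: "j < m" by simp
      have c: "col T j \<in> carrier_vec n" "B *\<^sub>v col T j \<in> carrier_vec m" using T B j by auto
      have "T *\<^sub>v (B *\<^sub>v col T j) = T * B *\<^sub>v col T j" using T B c by simp
      also have "\<dots> = T *\<^sub>v unit_vec m j" using TB c col j by simp
      finally have "T *\<^sub>v (B *\<^sub>v col T j - unit_vec m j) = 0\<^sub>v n"
        using T c by (subst mult_minus_distrib_mat_vec) auto
      then have "B *\<^sub>v col T j - unit_vec m j \<in> K" using c by (auto simp: K_def)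
      then have "B *\<^sub>v col T j - unit_vec m j = 0\<^sub>v m" using K0 by simp
      then have "B *\<^sub>v col T j = unit_vec m j"
        using c B by (auto simp: vec_eq_iff)
      then show "col (B * T) j = col (1\<^sub>m m) j" using T B j by (subst col_mult2) auto
    qed (use T B in auto)
    with TB B show ?thesis by blast
  qed (use zero in blast)
qed

text \<open>If \<open>c\<close> is an eigenvalue of \<open>T\<close>, then \<open>T\<close> minus
  \<open>c\<close> times the identity still commutes with \<open>\<rho>\<close> and kills an
  eigenvector. It is therefore not invertible, so it is zero by Schur's lemma.\<close>

lemma commuting_matrix_scalar:
  assumes G: "group G" and \<rho>: "irreducible_rep G n \<rho>" and T: "T \<in> carrier_mat n n"
    and comm: "\<And>h. h \<in> carrier G \<Longrightarrow> \<rho> h * T = T * \<rho> h"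
  obtains c where "T = c \<cdot>\<^sub>m 1\<^sub>m n"
proof -
  note R = irreducible_repD[OF G \<rho>]
  \<comment> \<open>An eigenvalue exists because the field is algebraically closed and
    \<open>n\<close> is positive.\<close>
  obtain c where "c \<in> spectrum T" using spectrum_non_empty[OF T R(2)] by blast
  then obtain v where v: "v \<in> carrier_vec n" "v \<noteq> 0\<^sub>v n" "T *\<^sub>v v = c \<cdot>\<^sub>v v"
    using T by (auto simp: spectrum_def eigenvalue_def eigenvector_def)
  define D where "D = T - c \<cdot>\<^sub>m 1\<^sub>m n"
  have D: "D \<in> carrier_mat n n" using T by (auto simp: D_def)
  have "\<rho> h * D = D * \<rho> h" if h: "h \<in> carrier G" for h
  proof -
    have Rc: "\<rho> h \<in> carrier_mat n n" using R(1) h by (auto simp: matrix_rep_def)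
    have "\<rho> h * D = \<rho> h * T - c \<cdot>\<^sub>m \<rho> h"
      unfolding D_def using Rc T by (subst mult_minus_distrib_mat) auto
    moreover have "D * \<rho> h = T * \<rho> h - c \<cdot>\<^sub>m \<rho> h"
      unfolding D_def using Rc T by (subst minus_mult_distrib_mat) auto
    ultimately show ?thesis using comm[OF h] by simp
  qed
  then consider "D = 0\<^sub>m n n" | B where "B \<in> carrier_mat n n" "B * D = 1\<^sub>m n"
    using intertwiner_zero_or_invertible[OF G \<rho> \<rho> D] by blast
  then show ?thesis
  proof cases
    case 1
    then have "T = c \<cdot>\<^sub>m 1\<^sub>m n" using T unfolding D_def by (auto simp: mat_eq_iff)
    then show ?thesis by (rule that)
  next
    case 2
    have "(c \<cdot>\<^sub>m 1\<^sub>m n) *\<^sub>v v = c \<cdot>\<^sub>v v"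
      using v by (intro eq_vecI) (auto simp: smult_scalar_prod_distrib[of _ n])
    then have "D *\<^sub>v v = 0\<^sub>v n" unfolding D_def using T v
      by (subst minus_mult_distrib_mat_vec) auto
    moreover have "B *\<^sub>v 0\<^sub>v n = 0\<^sub>v n" using 2 by (intro eq_vecI) auto
    moreover have "(B * D) *\<^sub>v v = B *\<^sub>v (D *\<^sub>v v)" using 2 D v by (intro assoc_mult_mat_vec) auto
    ultimately have "1\<^sub>m n *\<^sub>v v = 0\<^sub>v n" using 2 by simp
    then show ?thesis using 2 v by simp
  qed
qed

subsection \<open>Orthogonality of irreducible characters\<close>

lemma matrix_repD:
  assumes "matrix_rep G n \<rho>"
  shows "\<And>g. g \<in> carrier G \<Longrightarrow> \<rho> g \<in> carrier_mat n n"
    "\<And>g h. g \<in> carrier G \<Longrightarrow> h \<in> carrier G \<Longrightarrow> \<rho> (g \<otimes>\<^bsub>G\<^esub> h) = \<rho> g * \<rho> h"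
    "\<rho> \<one>\<^bsub>G\<^esub> = 1\<^sub>m n"
  using assms by (auto simp: matrix_rep_def)

lemma matrix_rep_index:
  assumes "matrix_rep G n \<rho>" "g \<in> carrier G" "h \<in> carrier G" "i < n" "j < n"
  shows "\<rho> (g \<otimes>\<^bsub>G\<^esub> h) $$ (i, j) = (\<Sum>l<n. \<rho> g $$ (i, l) * \<rho> h $$ (l, j))"
  unfolding matrix_repD(2)[OF assms(1-3)]
  by (rule index_mult_mat_sum[OF matrix_repD(1)[OF assms(1,2)] matrix_repD(1)[OF assms(1,3)] assms(4,5)])

lemma Irr_cases:
  assumes "group G" "\<psi> \<in> Irr G"
  obtains n \<rho> where "irreducible_rep G n \<rho>" "\<And>g. g \<in> carrier G \<Longrightarrow> \<psi> g = mat_trace (\<rho> g)"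
    "\<psi> = (\<lambda>g\<in>carrier G. mat_trace (\<rho> g))" "\<psi> \<one>\<^bsub>G\<^esub> = of_nat n" "n > 0"
proof -
  interpret group G by fact
  obtain n \<rho> where r: "irreducible_rep G n \<rho>" "\<psi> = (\<lambda>g\<in>carrier G. mat_trace (\<rho> g))"
    using assms(2) by (auto simp: Irr_def)
  note R = irreducible_repD[OF assms(1) r(1)]
  show ?thesis by (rule that[OF r(1) _ r(2)]) (use R(2) matrix_repD(3)[OF R(1)] in \<open>auto simp: r(2)\<close>)
qed

context group
begin

text \<open>The sum of \<open>\<rho>(g) E \<sigma>(g)\<inverse>\<close> over the group, where \<open>E\<close> is the matrix unit with entry 1 at
  \<open>(i, j)\<close>.\<close>

definition avg_mat :: "nat \<Rightarrow> nat \<Rightarrow> ('a \<Rightarrow> complex mat) \<Rightarrow> ('a \<Rightarrow> complex mat) \<Rightarrow> nat \<Rightarrow> nat \<Rightarrow> complex mat" where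
  "avg_mat n m \<rho> \<sigma> i j =
     mat n m (\<lambda>(a, b). \<Sum>g\<in>carrier G. \<rho> g $$ (a, i) * \<sigma> (inv g) $$ (j, b))"

lemma avg_mat_carrier [simp]: "avg_mat n m \<rho> \<sigma> i j \<in> carrier_mat n m"
  by (simp add: avg_mat_def)

text \<open>Replacing \<open>g\<close> by \<open>inv h \<otimes> g\<close> in the averaged sum turns
  a factor \<open>\<rho> h\<close> on the left into a factor \<open>\<sigma> h\<close> on the
  right.\<close>

lemma avg_mat_intertwines:
  assumes \<rho>: "matrix_rep G n \<rho>" and \<sigma>: "matrix_rep G m \<sigma>" and ij: "i < n" "j < m"
    and h: "h \<in> carrier G"
  shows "\<rho> h * avg_mat n m \<rho> \<sigma> i j = avg_mat n m \<rho> \<sigma> i j * \<sigma> h"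
proof (rule eq_matI)
  let ?T = "avg_mat n m \<rho> \<sigma> i j"
  have T: "?T \<in> carrier_mat n m" by simp
  fix a b assume "a < dim_row (?T * \<sigma> h)" "b < dim_col (?T * \<sigma> h)"
  then have ab: "a < n" "b < m" using matrix_repD(1)[OF \<sigma> h] by (auto simp: avg_mat_def)
  have "(\<rho> h * ?T) $$ (a, b) = (\<Sum>c<n. \<rho> h $$ (a, c) * (\<Sum>g\<in>carrier G. \<rho> g $$ (c, i) * \<sigma> (inv g) $$ (j, b)))"
    using index_mult_mat_sum[OF matrix_repD(1)[OF \<rho> h] T ab] ab by (simp add: avg_mat_def)
  also have "\<dots> = (\<Sum>g\<in>carrier G. (\<Sum>c<n. \<rho> h $$ (a, c) * \<rho> g $$ (c, i)) * \<sigma> (inv g) $$ (j, b))"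
    unfolding sum_distrib_left sum_distrib_right by (subst sum.swap) (simp add: mult.assoc)
  also have "\<dots> = (\<Sum>g\<in>carrier G. \<rho> (h \<otimes> g) $$ (a, i) * \<sigma> (inv g) $$ (j, b))"
    using h ab ij by (intro sum.cong refl) (simp add: matrix_rep_index[OF \<rho>])
  also have "\<dots> = (\<Sum>g\<in>carrier G. \<rho> g $$ (a, i) * \<sigma> (inv g \<otimes> h) $$ (j, b))"
    by (rule sum.reindex_bij_witness[of _ "\<lambda>g. inv h \<otimes> g" "\<lambda>g. h \<otimes> g"])
       (use h in \<open>auto simp: m_assoc[symmetric] inv_mult_group, simp add: m_assoc\<close>)
  also have "\<dots> = (\<Sum>g\<in>carrier G. \<rho> g $$ (a, i) * (\<Sum>c<m. \<sigma> (inv g) $$ (j, c) * \<sigma> h $$ (c, b)))"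
    using h ab ij by (intro sum.cong refl) (simp add: matrix_rep_index[OF \<sigma>])
  also have "\<dots> = (\<Sum>c<m. (\<Sum>g\<in>carrier G. \<rho> g $$ (a, i) * \<sigma> (inv g) $$ (j, c)) * \<sigma> h $$ (c, b))"
    unfolding sum_distrib_left sum_distrib_right by (subst sum.swap) (simp add: mult.assoc)
  also have "\<dots> = (?T * \<sigma> h) $$ (a, b)"
    using index_mult_mat_sum[OF T matrix_repD(1)[OF \<sigma> h] ab] ab by (simp add: avg_mat_def)
  finally show "(\<rho> h * ?T) $$ (a, b) = (?T * \<sigma> h) $$ (a, b)" .
qed (use matrix_repD(1)[OF \<rho> h] matrix_repD(1)[OF \<sigma> h] in \<open>simp_all add: avg_mat_def\<close>)

text \<open>The product of two traces is a double sum over diagonal entries, and the entry at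
  \<open>(i, j)\<close> of the average of the matrix unit at \<open>(i, j)\<close> collects exactly
  the term for \<open>i\<close> and \<open>j\<close>. This carries Schur's lemma over to
  characters.\<close>

lemma sum_trace_avg_mat:
  assumes \<rho>: "matrix_rep G n \<rho>" and \<sigma>: "matrix_rep G m \<sigma>"
  shows "(\<Sum>g\<in>carrier G. mat_trace (\<rho> g) * mat_trace (\<sigma> (inv g))) =
    (\<Sum>i<n. \<Sum>j<m. avg_mat n m \<rho> \<sigma> i j $$ (i, j))"
proof -
  have "(\<Sum>g\<in>carrier G. mat_trace (\<rho> g) * mat_trace (\<sigma> (inv g))) =
      (\<Sum>g\<in>carrier G. \<Sum>i<n. \<Sum>j<m. \<rho> g $$ (i, i) * \<sigma> (inv g) $$ (j, j))"
  proof (rule sum.cong[OF refl])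
    fix g assume "g \<in> carrier G"
    then have "\<rho> g \<in> carrier_mat n n" "\<sigma> (inv g) \<in> carrier_mat m m"
      using matrix_repD(1)[OF \<rho>] matrix_repD(1)[OF \<sigma>] by auto
    then show "mat_trace (\<rho> g) * mat_trace (\<sigma> (inv g)) =
        (\<Sum>i<n. \<Sum>j<m. \<rho> g $$ (i, i) * \<sigma> (inv g) $$ (j, j))"
      by (simp add: mat_trace_def sum_product)
  qed
  also have "\<dots> = (\<Sum>i<n. \<Sum>j<m. \<Sum>g\<in>carrier G. \<rho> g $$ (i, i) * \<sigma> (inv g) $$ (j, j))"
    by (subst sum.swap, rule sum.cong[OF refl], rule sum.swap)
  also have "\<dots> = (\<Sum>i<n. \<Sum>j<m. avg_mat n m \<rho> \<sigma> i j $$ (i, j))"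
    by (simp add: avg_mat_def)
  finally show ?thesis .
qed

text \<open>Every averaged matrix is scalar by Schur's lemma, and its trace determines the scalar:
  the group order divided by \<open>n\<close> if \<open>i = j\<close>, and zero otherwise. The
  \<open>n\<close> diagonal contributions add up to the group order.\<close>

lemma irreducible_trace_norm:
  assumes \<rho>: "irreducible_rep G n \<rho>"
  shows "(\<Sum>g\<in>carrier G. mat_trace (\<rho> g) * mat_trace (\<rho> (inv g))) = of_nat (card (carrier G))"
proof -
  note R = irreducible_repD[OF group_axioms \<rho>]
  have diag: "avg_mat n n \<rho> \<rho> i j $$ (i, j) = (if i = j then of_nat (card (carrier G)) / of_nat n else 0)"
    if ij: "i < n" "j < n" for i j
  proof -
    let ?T = "avg_mat n n \<rho> \<rho> i j"
    obtain c where c: "?T = c \<cdot>\<^sub>m 1\<^sub>m n"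
      using commuting_matrix_scalar[OF group_axioms \<rho> _ avg_mat_intertwines[OF R(1) R(1) ij]]
      by auto
    \<comment> \<open>Inside the trace the two factors combine to
      \<open>\<rho> (inv g \<otimes> g)\<close>, the identity matrix, for every
      \<open>g\<close>.\<close>
    have "of_nat n * c = mat_trace ?T" unfolding c by (simp add: mat_trace_def)
    also have "\<dots> = (\<Sum>a<n. \<Sum>g\<in>carrier G. \<rho> g $$ (a, i) * \<rho> (inv g) $$ (j, a))"
      by (simp add: mat_trace_def avg_mat_def)
    also have "\<dots> = (\<Sum>g\<in>carrier G. \<Sum>a<n. \<rho> (inv g) $$ (j, a) * \<rho> g $$ (a, i))"
      by (subst sum.swap) (simp add: mult.commute)
    also have "\<dots> = (\<Sum>g\<in>carrier G. \<rho> (inv g \<otimes> g) $$ (j, i))"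
      using ij by (intro sum.cong refl matrix_rep_index[OF R(1), symmetric]) auto
    also have "\<dots> = (if i = j then of_nat (card (carrier G)) else 0)"
      using ij matrix_repD(3)[OF R(1)] by simp
    finally have "c = (if i = j then of_nat (card (carrier G)) / of_nat n else 0)"
      using R(2) by (auto simp: field_simps split: if_splits)
    then show ?thesis using c ij by simp
  qed
  have "(\<Sum>i<n. \<Sum>j<n. avg_mat n n \<rho> \<rho> i j $$ (i, j)) =
      (\<Sum>i<n. \<Sum>j<n. if i = j then of_nat (card (carrier G)) / of_nat n else 0)"
    using diag by (intro sum.cong refl) auto
  also have "\<dots> = of_nat (card (carrier G))" using R(2) by simp
  finally show ?thesis using sum_trace_avg_mat[OF R(1) R(1)] by simp
qed

text \<open>First orthogonality relation, with \<open>inv g\<close> in the place of complex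
  conjugation. For distinct characters all averaged matrices vanish, since an invertible intertwiner
  would conjugate one representation into the other and make the traces equal.\<close>

lemma Irr_orthogonality:
  assumes \<psi>: "\<psi> \<in> Irr G" and \<phi>: "\<phi> \<in> Irr G"
  shows "(\<Sum>g\<in>carrier G. \<psi> g * \<phi> (inv g)) = (if \<psi> = \<phi> then of_nat (card (carrier G)) else 0)"
proof -
  obtain n \<rho> where \<rho>: "irreducible_rep G n \<rho>" "\<And>g. g \<in> carrier G \<Longrightarrow> \<psi> g = mat_trace (\<rho> g)"
    "\<psi> = (\<lambda>g\<in>carrier G. mat_trace (\<rho> g))"
    using Irr_cases[OF group_axioms \<psi>] by metis
  obtain m \<sigma> where \<sigma>: "irreducible_rep G m \<sigma>" "\<And>g. g \<in> carrier G \<Longrightarrow> \<phi> g = mat_trace (\<sigma> g)"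
    "\<phi> = (\<lambda>g\<in>carrier G. mat_trace (\<sigma> g))"
    using Irr_cases[OF group_axioms \<phi>] by metis
  note R = irreducible_repD[OF group_axioms \<rho>(1)] and S = irreducible_repD[OF group_axioms \<sigma>(1)]
  show ?thesis
  proof (cases "\<psi> = \<phi>")
    case True
    \<comment> \<open>Equal characters may come with different representations;
      \<open>\<rho>\<close> is taken for both factors.\<close>
    then have "\<phi> (inv g) = mat_trace (\<rho> (inv g))" if "g \<in> carrier G" for g
      using \<rho>(2) that by auto
    then show ?thesis using True irreducible_trace_norm[OF \<rho>(1)] \<rho>(2) by simp
  next
    case False
    have zero: "avg_mat n m \<rho> \<sigma> i j = 0\<^sub>m n m" if ij: "i < n" "j < m" for i j
    proof (rule ccontr)
      let ?T = "avg_mat n m \<rho> \<sigma> i j"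
      assume "?T \<noteq> 0\<^sub>m n m"
      then obtain B where B: "B \<in> carrier_mat m n" "?T * B = 1\<^sub>m n" "B * ?T = 1\<^sub>m m"
        using intertwiner_zero_or_invertible[OF group_axioms \<rho>(1) \<sigma>(1) _ avg_mat_intertwines[OF R(1) S(1) ij]]
        by auto
      have "mat_trace (\<rho> g) = mat_trace (\<sigma> g)" if g: "g \<in> carrier G" for g
      proof -
        have c: "\<rho> g \<in> carrier_mat n n" "\<sigma> g \<in> carrier_mat m m" "?T \<in> carrier_mat n m"
          using matrix_repD(1)[OF R(1) g] matrix_repD(1)[OF S(1) g] by simp_all
        have "\<rho> g = \<rho> g * (?T * B)" using c B by simp
        also have "\<dots> = \<rho> g * ?T * B" using c B assoc_mult_mat[of "\<rho> g" n n ?T m B n] by simp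
        also have "\<dots> = ?T * \<sigma> g * B" using avg_mat_intertwines[OF R(1) S(1) ij g] by simp
        also have "\<dots> = ?T * (\<sigma> g * B)" using c B assoc_mult_mat[of ?T n m "\<sigma> g" m B n] by simp
        finally have "mat_trace (\<rho> g) = mat_trace (?T * (\<sigma> g * B))" by simp
        also have "\<dots> = mat_trace ((\<sigma> g * B) * ?T)" using c B mat_trace_mult_comm[OF c(3), of "\<sigma> g * B"] by simp
        also have "(\<sigma> g * B) * ?T = \<sigma> g * (B * ?T)" using c B assoc_mult_mat[of "\<sigma> g" m m B n ?T m] by simp
        also have "\<dots> = \<sigma> g" using c B by simp
        finally show ?thesis .
      qed
      then have "\<psi> = \<phi>" unfolding \<rho>(3) \<sigma>(3) by (intro restrict_ext) auto
      with False show False by simp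
    qed
    have "(\<Sum>g\<in>carrier G. \<psi> g * \<phi> (inv g)) = (\<Sum>i<n. \<Sum>j<m. avg_mat n m \<rho> \<sigma> i j $$ (i, j))"
      using sum_trace_avg_mat[OF R(1) S(1)] \<rho>(2) \<sigma>(2) by simp
    also have "\<dots> = 0" using zero by (intro sum.neutral ballI) simp
    finally show ?thesis using False by simp
  qed
qed

text \<open>The sum of the matrices \<open>\<rho>(y)\<close> over \<open>y \<in> N\<close> commutes with \<open>\<rho>\<close> because \<open>N\<close> is normal, so it is
  scalar, and its trace shows that the scalar is \<open>card N\<close>. Multiplying it by \<open>\<rho>(x)\<close> only permutes
  the summands. This avoids eigenvalues.\<close>

lemma normal_char_ker_rep_trivial:
  assumes fin: "finite (carrier G)" and \<rho>: "irreducible_rep G n \<rho>" and N: "N \<lhd> G"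
    and tr: "\<And>x. x \<in> N \<Longrightarrow> mat_trace (\<rho> x) = of_nat n" and x: "x \<in> N"
  shows "\<rho> x = 1\<^sub>m n"
proof -
  interpret N: normal N G by fact
  note R = irreducible_repD[OF group_axioms \<rho>]
  note rc = matrix_repD(1)[OF R(1)]
  have finN: "finite N" using fin N.subset finite_subset by blast
  have cN: "card N > 0" using finN x by (auto simp: card_gt_0_iff)
  define P where "P = mat n n (\<lambda>(a, b). \<Sum>y\<in>N. \<rho> y $$ (a, b))"
  have P: "P \<in> carrier_mat n n" by (simp add: P_def)
  have left: "\<rho> h * P = mat n n (\<lambda>(a, b). \<Sum>y\<in>N. \<rho> (h \<otimes> y) $$ (a, b))" if h: "h \<in> carrier G" for h
  proof (rule eq_matI)
    fix a b assume "a < dim_row (mat n n (\<lambda>(a, b). \<Sum>y\<in>N. \<rho> (h \<otimes> y) $$ (a, b)))"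
      "b < dim_col (mat n n (\<lambda>(a, b). \<Sum>y\<in>N. \<rho> (h \<otimes> y) $$ (a, b)))"
    then have ab: "a < n" "b < n" by auto
    have "(\<rho> h * P) $$ (a, b) = (\<Sum>c<n. \<rho> h $$ (a, c) * (\<Sum>y\<in>N. \<rho> y $$ (c, b)))"
      using index_mult_mat_sum[OF rc[OF h] P ab] ab by (simp add: P_def)
    also have "\<dots> = (\<Sum>y\<in>N. \<Sum>c<n. \<rho> h $$ (a, c) * \<rho> y $$ (c, b))"
      unfolding sum_distrib_left by (rule sum.swap)
    also have "\<dots> = (\<Sum>y\<in>N. \<rho> (h \<otimes> y) $$ (a, b))"
      using h ab N.subset by (intro sum.cong refl) (simp add: matrix_rep_index[OF R(1)] subset_iff)
    finally show "(\<rho> h * P) $$ (a, b) = mat n n (\<lambda>(a, b). \<Sum>y\<in>N. \<rho> (h \<otimes> y) $$ (a, b)) $$ (a, b)"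
      using ab by simp
  qed (use rc[OF h] P in auto)
  have right: "P * \<rho> h = mat n n (\<lambda>(a, b). \<Sum>y\<in>N. \<rho> (y \<otimes> h) $$ (a, b))" if h: "h \<in> carrier G" for h
  proof (rule eq_matI)
    fix a b assume "a < dim_row (mat n n (\<lambda>(a, b). \<Sum>y\<in>N. \<rho> (y \<otimes> h) $$ (a, b)))"
      "b < dim_col (mat n n (\<lambda>(a, b). \<Sum>y\<in>N. \<rho> (y \<otimes> h) $$ (a, b)))"
    then have ab: "a < n" "b < n" by auto
    have "(P * \<rho> h) $$ (a, b) = (\<Sum>c<n. (\<Sum>y\<in>N. \<rho> y $$ (a, c)) * \<rho> h $$ (c, b))"
      using index_mult_mat_sum[OF P rc[OF h] ab] ab by (simp add: P_def)
    also have "\<dots> = (\<Sum>y\<in>N. \<Sum>c<n. \<rho> y $$ (a, c) * \<rho> h $$ (c, b))"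
      unfolding sum_distrib_right by (rule sum.swap)
    also have "\<dots> = (\<Sum>y\<in>N. \<rho> (y \<otimes> h) $$ (a, b))"
      using h ab N.subset by (intro sum.cong refl) (simp add: matrix_rep_index[OF R(1)] subset_iff)
    finally show "(P * \<rho> h) $$ (a, b) = mat n n (\<lambda>(a, b). \<Sum>y\<in>N. \<rho> (y \<otimes> h) $$ (a, b)) $$ (a, b)"
      using ab by simp
  qed (use rc[OF h] P in auto)
  have "\<rho> h * P = P * \<rho> h" if h: "h \<in> carrier G" for h
  proof -
    have cancel: "h \<otimes> (inv h \<otimes> z) = z" "inv h \<otimes> (h \<otimes> z) = z" if "z \<in> carrier G" for z
      using h that by (simp_all add: m_assoc[symmetric])
    \<comment> \<open>Conjugation by \<open>h\<close> permutes \<open>N\<close>, and the conjugate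
      of \<open>y\<close> times \<open>h\<close> is \<open>h \<otimes> y\<close>.\<close>
    have "(\<Sum>y\<in>N. \<rho> (h \<otimes> y) $$ (a, b)) = (\<Sum>y\<in>N. \<rho> (y \<otimes> h) $$ (a, b))" for a b
    proof (rule sum.reindex_bij_witness[of _ "\<lambda>y. inv h \<otimes> y \<otimes> h" "\<lambda>y. h \<otimes> y \<otimes> inv h"])
      fix y assume y: "y \<in> N"
      then have yc: "y \<in> carrier G" using N.subset by auto
      show "inv h \<otimes> (h \<otimes> y \<otimes> inv h) \<otimes> h = y"
        using h yc cancel by (simp add: m_assoc)
      show "h \<otimes> (inv h \<otimes> y \<otimes> h) \<otimes> inv h = y"
        using h yc cancel by (simp add: m_assoc)
      show "h \<otimes> y \<otimes> inv h \<in> N" using N.inv_op_closed2 h y by simp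
      show "inv h \<otimes> y \<otimes> h \<in> N" using N.inv_op_closed1 h y by simp
      show "\<rho> (h \<otimes> y \<otimes> inv h \<otimes> h) $$ (a, b) = \<rho> (h \<otimes> y) $$ (a, b)"
        using h yc by (simp add: m_assoc)
    qed
    then show ?thesis unfolding left[OF h] right[OF h] by simp
  qed
  then obtain c where c: "P = c \<cdot>\<^sub>m 1\<^sub>m n"
    using commuting_matrix_scalar[OF group_axioms \<rho> P] by blast
  have "of_nat n * c = mat_trace P" unfolding c by (simp add: mat_trace_def)
  also have "\<dots> = (\<Sum>a<n. \<Sum>y\<in>N. \<rho> y $$ (a, a))" by (simp add: mat_trace_def P_def)
  also have "\<dots> = (\<Sum>y\<in>N. mat_trace (\<rho> y))"
  proof (subst sum.swap, rule sum.cong[OF refl])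
    fix y assume "y \<in> N"
    then have "\<rho> y \<in> carrier_mat n n" using rc N.subset by blast
    then show "(\<Sum>a<n. \<rho> y $$ (a, a)) = mat_trace (\<rho> y)" by (simp add: mat_trace_def)
  qed
  also have "\<dots> = of_nat n * of_nat (card N)" using tr by simp
  finally have c': "c = of_nat (card N)" using R(2) by simp
  have xc: "x \<in> carrier G" using x N.subset by auto
  have "(\<Sum>y\<in>N. \<rho> (x \<otimes> y) $$ (a, b)) = (\<Sum>y\<in>N. \<rho> y $$ (a, b))" for a b
    by (rule sum.reindex_bij_witness[of _ "\<lambda>y. inv x \<otimes> y" "\<lambda>y. x \<otimes> y"])
       (use x xc N.subset in \<open>auto simp: m_assoc[symmetric]\<close>)
  then have "\<rho> x * P = P" using left[OF xc] by (simp add: P_def)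
  then have "c \<cdot>\<^sub>m \<rho> x = c \<cdot>\<^sub>m 1\<^sub>m n" using rc[OF xc] mult_smult_distrib[OF rc[OF xc], of "1\<^sub>m n" n c] unfolding c by simp
  \<comment> \<open>The scalar cancels because \<open>N\<close> is finite and contains
    \<open>x\<close>, so that \<open>card N\<close> is nonzero.\<close>
  then show ?thesis using c' cN rc[OF xc] by (auto simp: mat_eq_iff)
qed

end

subsection \<open>Composition factors\<close>

lemma sum_lessThan_split:
  fixes f :: "nat \<Rightarrow> 'a :: comm_monoid_add"
  assumes "k \<le> n"
  shows "(\<Sum>l<n. f l) = (\<Sum>l<k. f l) + (\<Sum>l<n-k. f (l + k))"
proof -
  obtain m where n: "n = k + m" using assms le_Suc_ex by blast
  have "(\<Sum>l<k+m. f l) = (\<Sum>l<k. f l) + (\<Sum>l<m. f (l + k))"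
    by (induction m) (simp_all add: ac_simps)
  then show ?thesis by (simp add: n)
qed

text \<open>The first \<open>k\<close> unit vectors span an invariant subspace; \<open>A\<close> is
  the action on it and \<open>D\<close> the action on the quotient. Diagonal blocks of block
  triangular matrices multiply separately.\<close>

lemma block_triangular_rep:
  assumes \<sigma>: "matrix_rep G n \<sigma>" and k: "k \<le> n"
    and zero: "\<forall>g\<in>carrier G. \<forall>i\<in>{k..<n}. \<forall>j<k. \<sigma> g $$ (i, j) = 0"
    and G: "group G"
  defines "A \<equiv> \<lambda>g. mat k k (\<lambda>(i, j). \<sigma> g $$ (i, j))"
    and "D \<equiv> \<lambda>g. mat (n - k) (n - k) (\<lambda>(i, j). \<sigma> g $$ (i + k, j + k))"
  shows "matrix_rep G k A" "matrix_rep G (n - k) D"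
    "\<And>g. g \<in> carrier G \<Longrightarrow> mat_trace (\<sigma> g) = mat_trace (A g) + mat_trace (D g)"
    "\<And>g. \<sigma> g = 1\<^sub>m n \<Longrightarrow> A g = 1\<^sub>m k \<and> D g = 1\<^sub>m (n - k)"
proof -
  interpret group G by fact
  show one: "A g = 1\<^sub>m k \<and> D g = 1\<^sub>m (n - k)" if "\<sigma> g = 1\<^sub>m n" for g
    using that k by (auto simp: A_def D_def intro!: eq_matI)
  show "mat_trace (\<sigma> g) = mat_trace (A g) + mat_trace (D g)" if g: "g \<in> carrier G" for g
    using matrix_repD(1)[OF \<sigma> g] sum_lessThan_split[OF k, of "\<lambda>i. \<sigma> g $$ (i, i)"]
    by (simp add: mat_trace_def A_def D_def)
  have A: "A (g \<otimes>\<^bsub>G\<^esub> h) = A g * A h" if gh: "g \<in> carrier G" "h \<in> carrier G" for g h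
  proof (rule eq_matI)
    fix i j assume "i < dim_row (A g * A h)" "j < dim_col (A g * A h)"
    then have ij: "i < k" "j < k" by (auto simp: A_def)
    have c: "A g \<in> carrier_mat k k" "A h \<in> carrier_mat k k" by (auto simp: A_def)
    have "A (g \<otimes>\<^bsub>G\<^esub> h) $$ (i, j) = (\<Sum>l<n. \<sigma> g $$ (i, l) * \<sigma> h $$ (l, j))"
      using matrix_rep_index[OF \<sigma> gh, of i j] ij k by (simp add: A_def)
    \<comment> \<open>The terms with \<open>l\<close> at least \<open>k\<close> contain an entry of
      the zero block of \<open>\<sigma> h\<close>. For \<open>D\<close> below, it is the terms with
      \<open>l < k\<close> that drop out, through the zero block of
      \<open>\<sigma> g\<close>.\<close>
    also have "\<dots> = (\<Sum>l<k. \<sigma> g $$ (i, l) * \<sigma> h $$ (l, j))"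
      unfolding sum_lessThan_split[OF k] using zero gh(2) ij by simp
    also have "\<dots> = (A g * A h) $$ (i, j)"
      using index_mult_mat_sum[OF c ij] ij by (simp add: A_def)
    finally show "A (g \<otimes>\<^bsub>G\<^esub> h) $$ (i, j) = (A g * A h) $$ (i, j)" .
  qed (auto simp: A_def)
  have D: "D (g \<otimes>\<^bsub>G\<^esub> h) = D g * D h" if gh: "g \<in> carrier G" "h \<in> carrier G" for g h
  proof (rule eq_matI)
    fix i j assume "i < dim_row (D g * D h)" "j < dim_col (D g * D h)"
    then have ij: "i < n - k" "j < n - k" by (auto simp: D_def)
    have c: "D g \<in> carrier_mat (n - k) (n - k)" "D h \<in> carrier_mat (n - k) (n - k)" by (auto simp: D_def)
    have "D (g \<otimes>\<^bsub>G\<^esub> h) $$ (i, j) = (\<Sum>l<n. \<sigma> g $$ (i + k, l) * \<sigma> h $$ (l, j + k))"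
      using matrix_rep_index[OF \<sigma> gh, of "i + k" "j + k"] ij k by (simp add: D_def)
    also have "\<dots> = (\<Sum>l<n-k. \<sigma> g $$ (i + k, l + k) * \<sigma> h $$ (l + k, j + k))"
      unfolding sum_lessThan_split[OF k] using zero gh(1) ij by simp
    also have "\<dots> = (D g * D h) $$ (i, j)"
      using index_mult_mat_sum[OF c ij] ij by (simp add: D_def)
    finally show "D (g \<otimes>\<^bsub>G\<^esub> h) $$ (i, j) = (D g * D h) $$ (i, j)" .
  qed (auto simp: D_def)
  have "A \<one>\<^bsub>G\<^esub> = 1\<^sub>m k" "D \<one>\<^bsub>G\<^esub> = 1\<^sub>m (n - k)" using one matrix_repD(3)[OF \<sigma>] by auto
  then show "matrix_rep G k A" "matrix_rep G (n - k) D"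
    unfolding matrix_rep_def using A D by (auto simp: A_def D_def)
qed

text \<open>In a basis adapted to \<open>W\<close> the representation becomes block triangular, and
  conjugation preserves the trace. Since \<open>W\<close> is neither zero nor everything, both
  blocks have smaller degree, as the induction over the degree requires.\<close>

lemma reducible_rep_block_triangular:
  assumes G: "group G" and \<rho>: "matrix_rep G n \<rho>" and W: "invariant_subspace G n \<rho> W"
    and ne: "W \<noteq> {0\<^sub>v n}" "W \<noteq> carrier_vec n"
  obtains \<sigma> k where "matrix_rep G n \<sigma>" "0 < k" "k < n"
    "\<And>g. g \<in> carrier G \<Longrightarrow> mat_trace (\<sigma> g) = mat_trace (\<rho> g)"
    "\<And>g. \<rho> g = 1\<^sub>m n \<Longrightarrow> \<sigma> g = 1\<^sub>m n"
    "\<forall>g\<in>carrier G. \<forall>i\<in>{k..<n}. \<forall>j<k. \<sigma> g $$ (i, j) = 0"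
proof -
  interpret group G by fact
  note rc = matrix_repD(1)[OF \<rho>]
  have sub: "VectorSpace.subspace class_ring W (module_vec TYPE(complex) n)"
    and inv: "\<And>g w. g \<in> carrier G \<Longrightarrow> w \<in> W \<Longrightarrow> \<rho> g *\<^sub>v w \<in> W"
    using W by (auto simp: invariant_subspace_def)
  obtain P Q k where P: "P \<in> carrier_mat n n" and Q: "Q \<in> carrier_mat n n"
    and PQ: "P * Q = 1\<^sub>m n" and QP: "Q * P = 1\<^sub>m n" and k: "k \<le> n"
    and WP: "W = {P *\<^sub>v v | v. v \<in> carrier_vec n \<and> (\<forall>i. k \<le> i \<and> i < n \<longrightarrow> v $ i = 0)}"
    by (rule subspace_adapted_basis[OF sub])
  have "k \<noteq> 0"
  proof
    assume "k = 0"
    have "w = 0\<^sub>v n" if "w \<in> W" for w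
    proof -
      obtain v where v: "w = P *\<^sub>v v" "v \<in> carrier_vec n" "\<forall>i. k \<le> i \<and> i < n \<longrightarrow> v $ i = 0"
        using \<open>w \<in> W\<close> unfolding WP by blast
      then have "v = 0\<^sub>v n" using \<open>k = 0\<close> by (intro eq_vecI) auto
      then show ?thesis using v P by (intro eq_vecI) auto
    qed
    moreover have "0\<^sub>v n \<in> W" by (rule subspace_vecD(2)[OF sub])
    ultimately show False using ne by blast
  qed
  moreover have "k \<noteq> n"
  proof
    assume "k = n"
    have "w \<in> W" if "w \<in> carrier_vec n" for w
    proof -
      have "P *\<^sub>v (Q *\<^sub>v w) = (P * Q) *\<^sub>v w" using P Q that by (intro assoc_mult_mat_vec[symmetric]) auto
      then have "w = P *\<^sub>v (Q *\<^sub>v w)" using PQ that by simp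
      moreover have "Q *\<^sub>v w \<in> carrier_vec n" using Q that by simp
      ultimately show ?thesis unfolding WP using \<open>k = n\<close> by force
    qed
    then show False using ne subspace_vecD(1)[OF sub] by blast
  qed
  ultimately have k0: "0 < k" "k < n" using k by auto
  define \<sigma> where "\<sigma> g = Q * (\<rho> g * P)" for g
  have \<sigma>c: "\<sigma> g \<in> carrier_mat n n" if "g \<in> carrier G" for g
    using rc[OF that] P Q by (simp add: \<sigma>_def)
  have one: "\<sigma> g = 1\<^sub>m n" if "\<rho> g = 1\<^sub>m n" for g
    using that P QP by (simp add: \<sigma>_def)
  have "\<sigma> (g \<otimes>\<^bsub>G\<^esub> h) = \<sigma> g * \<sigma> h" if gh: "g \<in> carrier G" "h \<in> carrier G" for g h
  proof -
    note c = rc[OF gh(1)] rc[OF gh(2)] P Q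
    have "\<sigma> g * \<sigma> h = Q * ((\<rho> g * P) * (Q * (\<rho> h * P)))"
      unfolding \<sigma>_def using c by (intro assoc_mult_mat[of _ n n _ n _ n]) auto
    also have "(\<rho> g * P) * (Q * (\<rho> h * P)) = \<rho> g * (P * (Q * (\<rho> h * P)))"
      using c by (intro assoc_mult_mat[of _ n n _ n _ n]) auto
    also have "P * (Q * (\<rho> h * P)) = (P * Q) * (\<rho> h * P)"
      using c by (intro assoc_mult_mat[symmetric, of _ n n _ n _ n]) auto
    also have "\<dots> = \<rho> h * P" using PQ c by simp
    also have "\<rho> g * (\<rho> h * P) = (\<rho> g * \<rho> h) * P"
      using c by (intro assoc_mult_mat[symmetric, of _ n n _ n _ n]) auto
    finally show ?thesis using matrix_repD(2)[OF \<rho> gh] by (simp add: \<sigma>_def)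
  qed
  then have "matrix_rep G n \<sigma>"
    unfolding matrix_rep_def using \<sigma>c one matrix_repD(3)[OF \<rho>] by blast
  moreover have "mat_trace (\<sigma> g) = mat_trace (\<rho> g)" if g: "g \<in> carrier G" for g
  proof -
    note c = rc[OF g] P Q
    have "mat_trace (\<sigma> g) = mat_trace (\<rho> g * P * Q)"
      unfolding \<sigma>_def using c by (intro mat_trace_mult_comm) auto
    also have "\<rho> g * P * Q = \<rho> g * (P * Q)" using c by (intro assoc_mult_mat[of _ n n _ n _ n]) auto
    finally show ?thesis using PQ c by simp
  qed
  moreover have "\<forall>g\<in>carrier G. \<forall>i\<in>{k..<n}. \<forall>j<k. \<sigma> g $$ (i, j) = 0"
  proof (intro ballI allI impI)
    fix g i j assume g: "g \<in> carrier G" and "i \<in> {k..<n}" "j < k"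
    then have ij: "k \<le> i" "i < n" "j < k" by auto
    note c = rc[OF g] P Q
    \<comment> \<open>Column \<open>j\<close> of \<open>\<sigma> g\<close> is found by moving to
      \<open>W\<close> and back: \<open>P\<close> sends the unit vector into \<open>W\<close>,
      \<open>\<rho> g\<close> keeps it there, and \<open>Q\<close> returns a vector supported on the
      first \<open>k\<close> coordinates.\<close>
    have "P *\<^sub>v unit_vec n j \<in> W" unfolding WP using ij k by force
    then have "\<rho> g *\<^sub>v (P *\<^sub>v unit_vec n j) \<in> W" by (rule inv[OF g])
    then obtain v where v: "\<rho> g *\<^sub>v (P *\<^sub>v unit_vec n j) = P *\<^sub>v v" "v \<in> carrier_vec n"
      "\<forall>i. k \<le> i \<and> i < n \<longrightarrow> v $ i = 0" unfolding WP by blast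
    have "\<sigma> g *\<^sub>v unit_vec n j = Q *\<^sub>v ((\<rho> g * P) *\<^sub>v unit_vec n j)"
      unfolding \<sigma>_def using c by (intro assoc_mult_mat_vec[of _ n n _ n]) auto
    also have "(\<rho> g * P) *\<^sub>v unit_vec n j = P *\<^sub>v v"
      unfolding v(1)[symmetric] using c by (intro assoc_mult_mat_vec[of _ n n _ n]) auto
    also have "Q *\<^sub>v (P *\<^sub>v v) = (Q * P) *\<^sub>v v"
      using c v(2) by (intro assoc_mult_mat_vec[symmetric, of _ n n _ n]) auto
    finally have "\<sigma> g *\<^sub>v unit_vec n j = v" using QP v(2) by simp
    moreover have "(\<sigma> g *\<^sub>v unit_vec n j) $ i = \<sigma> g $$ (i, j)" using \<sigma>c[OF g] ij by simp
    ultimately show "\<sigma> g $$ (i, j) = 0" using v(3) ij by simp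
  qed
  ultimately show ?thesis using that[of \<sigma> k] k0 one by blast
qed

text \<open>Induction on the degree, splitting a reducible representation into its two diagonal
  blocks. A list is used because factors repeat. The last clause holds because an element acting as
  the identity does so on every factor; it will place the factors of the coset representation in
  \<open>X_ker\<close>.\<close>

lemma trace_composition_factors:
  assumes G: "group G" and \<rho>: "matrix_rep G n \<rho>"
  shows "\<exists>\<psi>s. set \<psi>s \<subseteq> Irr G \<and> (\<forall>g\<in>carrier G. mat_trace (\<rho> g) = (\<Sum>\<psi>\<leftarrow>\<psi>s. \<psi> g)) \<and>
    (\<forall>\<psi>\<in>set \<psi>s. {g \<in> carrier G. \<rho> g = 1\<^sub>m n} \<subseteq> char_ker G \<psi>)"
  using \<rho>
proof (induction n arbitrary: \<rho> rule: less_induct)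
  case (less n)
  interpret group G by fact
  note rc = matrix_repD(1)[OF less.prems]
  consider "n = 0" | "irreducible_rep G n \<rho>" |
    W where "invariant_subspace G n \<rho> W" "W \<noteq> {0\<^sub>v n}" "W \<noteq> carrier_vec n"
    using less.prems hom_GLC_iff_matrix_rep[OF G] unfolding irreducible_rep_def by blast
  then show ?case
  proof cases
    case 1
    \<comment> \<open>Irreducibility demands positive degree, so degree zero is treated apart, with
      the empty list.\<close>
    have "mat_trace (\<rho> g) = 0" if "g \<in> carrier G" for g
      using rc[OF that] 1 by (simp add: mat_trace_def)
    then show ?thesis by (intro exI[of _ "[]"]) simp
  next
    case 2
    then have "(\<lambda>g\<in>carrier G. mat_trace (\<rho> g)) \<in> Irr G" unfolding Irr_def by blast
    then show ?thesis
      using matrix_repD(3)[OF less.prems]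
      by (intro exI[of _ "[\<lambda>g\<in>carrier G. mat_trace (\<rho> g)]"]) (auto simp: char_ker_def)
  next
    case 3
    obtain \<sigma> k where \<sigma>: "matrix_rep G n \<sigma>" and k: "0 < k" "k < n"
      and tr: "\<And>g. g \<in> carrier G \<Longrightarrow> mat_trace (\<sigma> g) = mat_trace (\<rho> g)"
      and one: "\<And>g. \<rho> g = 1\<^sub>m n \<Longrightarrow> \<sigma> g = 1\<^sub>m n"
      and zero: "\<forall>g\<in>carrier G. \<forall>i\<in>{k..<n}. \<forall>j<k. \<sigma> g $$ (i, j) = 0"
      by (rule reducible_rep_block_triangular[OF G less.prems 3]) blast
    define A where "A g = mat k k (\<lambda>(i, j). \<sigma> g $$ (i, j))" for g
    define D where "D g = mat (n - k) (n - k) (\<lambda>(i, j). \<sigma> g $$ (i + k, j + k))" for g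
    note b = block_triangular_rep[OF \<sigma> less_imp_le[OF k(2)] zero G, folded A_def D_def]
    obtain \<psi>s where 1: "set \<psi>s \<subseteq> Irr G" "\<forall>g\<in>carrier G. mat_trace (A g) = (\<Sum>\<psi>\<leftarrow>\<psi>s. \<psi> g)"
      "\<forall>\<psi>\<in>set \<psi>s. {g \<in> carrier G. A g = 1\<^sub>m k} \<subseteq> char_ker G \<psi>"
      using less.IH[OF k(2) b(1)] by blast
    obtain \<phi>s where 2: "set \<phi>s \<subseteq> Irr G" "\<forall>g\<in>carrier G. mat_trace (D g) = (\<Sum>\<psi>\<leftarrow>\<phi>s. \<psi> g)"
      "\<forall>\<psi>\<in>set \<phi>s. {g \<in> carrier G. D g = 1\<^sub>m (n - k)} \<subseteq> char_ker G \<psi>"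
      using less.IH[OF _ b(2)] k by auto
    have "set (\<psi>s @ \<phi>s) \<subseteq> Irr G" using 1 2 by simp
    moreover have "\<forall>g\<in>carrier G. mat_trace (\<rho> g) = (\<Sum>\<psi>\<leftarrow>\<psi>s @ \<phi>s. \<psi> g)"
      using 1 2 tr b(3) by simp
    moreover have "\<forall>\<psi>\<in>set (\<psi>s @ \<phi>s). {g \<in> carrier G. \<rho> g = 1\<^sub>m n} \<subseteq> char_ker G \<psi>"
      using 1(3) 2(3) b(4)[OF one] by fastforce
    ultimately show ?thesis by blast
  qed
qed

subsection \<open>The permutation character on cosets\<close>

lemma sum_list_map_eq_sum_of_nat_count:
  fixes f :: "'b \<Rightarrow> 'a :: semiring_1"
  assumes "finite A" "set xs \<subseteq> A"
  shows "(\<Sum>x\<leftarrow>xs. f x) = (\<Sum>x\<in>A. of_nat (count_list xs x) * f x)"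
  using assms(2)
proof (induction xs)
  case (Cons y xs)
  have "(\<Sum>x\<in>A. of_nat (count_list (y # xs) x) * f x) =
      (\<Sum>x\<in>A. (if x = y then f x else 0) + of_nat (count_list xs x) * f x)"
    by (intro sum.cong) (auto simp: algebra_simps)
  then show ?case using Cons assms(1) by (simp add: sum.distrib)
qed simp

context normal
begin

text \<open>By normality the right coset of \<open>a\<close> is also its left coset, so left
  multiplication acts on the right cosets.\<close>

lemma lcos_rcos:
  assumes "g \<in> carrier G" "a \<in> carrier G"
  shows "g <# (H #> a) = H #> (g \<otimes> a)"
  using assms coset_eq lcos_m_assoc[OF subset, of g a] by simp

text \<open>Fixing the coset of \<open>a\<close> means that
  \<open>g \<otimes> a \<otimes> inv a\<close>, which is \<open>g\<close>, lies in \<open>H\<close>.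
  Hence an element fixes all cosets or none.\<close>

lemma lcos_rcos_fixed_iff:
  assumes g: "g \<in> carrier G" and C: "C \<in> rcosets H"
  shows "g <# C = C \<longleftrightarrow> g \<in> H"
proof -
  obtain a where a: "a \<in> carrier G" "C = H #> a" using C by (auto simp: RCOSETS_def)
  show ?thesis unfolding a(2) lcos_rcos[OF g a(1)]
  proof
    assume "H #> (g \<otimes> a) = H #> a"
    then have "g \<otimes> a \<in> H #> a" using rcos_self[of "g \<otimes> a" H] g a subgroup_axioms by simp
    then have "g \<otimes> a \<otimes> inv a \<in> H" using rcos_module_imp[OF group_axioms a(1)] by blast
    then show "g \<in> H" using g a by (simp add: m_assoc)
  next
    assume "g \<in> H"
    then have "H #> g = H" using rcos_const group_axioms by blast
    then show "H #> (g \<otimes> a) = H #> a" using coset_mult_assoc[OF subset g a(1)] by simp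
  qed
qed

text \<open>The permutation matrices of the action on the cosets, numbered by \<open>e\<close>. The
  trace counts fixed cosets.\<close>

lemma coset_permutation_rep:
  assumes fin: "finite (carrier G)"
  defines "m \<equiv> card (rcosets H)"
  obtains \<pi> where "matrix_rep G m \<pi>" "\<And>x. x \<in> H \<Longrightarrow> \<pi> x = 1\<^sub>m m"
    "\<And>g. g \<in> carrier G \<Longrightarrow> mat_trace (\<pi> g) = (if g \<in> H then of_nat m else 0)"
proof -
  have "rcosets H \<subseteq> Pow (carrier G)" using rcosets_carrier[OF group_axioms] by blast
  then have "finite (rcosets H)" using fin finite_subset by blast
  then obtain e where e: "bij_betw e {..<m} (rcosets H)"
    using ex_bij_betw_nat_finite unfolding m_def atLeast0LessThan by blast
  have e_in: "e i \<in> rcosets H" if "i < m" for i using e that by (auto simp: bij_betw_def)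
  have e_inj: "e i = e j \<longleftrightarrow> i = j" if "i < m" "j < m" for i j
    using e that by (auto simp: bij_betw_def inj_on_def)
  have e_surj: "\<exists>i<m. e i = C" if "C \<in> rcosets H" for C
    using bij_betw_imp_surj_on[OF e] that by (metis imageE lessThan_iff)
  have act: "g <# C \<in> rcosets H" if g: "g \<in> carrier G" and C: "C \<in> rcosets H" for g C
  proof -
    obtain a where "a \<in> carrier G" "C = H #> a" using C by (auto simp: RCOSETS_def)
    then show ?thesis using lcos_rcos g rcosetsI[OF subset] by simp
  qed
  define \<pi> :: "'a \<Rightarrow> complex mat"
    where "\<pi> g = mat m m (\<lambda>(i, j). if e i = g <# e j then 1 else 0)" for g
  have \<pi>c: "\<pi> g \<in> carrier_mat m m" for g by (simp add: \<pi>_def)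
  have one: "\<pi> x = 1\<^sub>m m" if x: "x \<in> H" for x
  proof (rule eq_matI)
    fix i j assume "i < dim_row (1\<^sub>m m)" "j < dim_col (1\<^sub>m m)"
    then have ij: "i < m" "j < m" by auto
    have "x <# e j = e j" using lcos_rcos_fixed_iff[of x "e j"] x subset e_in[OF ij(2)] by blast
    then show "\<pi> x $$ (i, j) = 1\<^sub>m m $$ (i, j)" using ij e_inj by (simp add: \<pi>_def)
  qed (auto simp: \<pi>_def)
  have "\<pi> (g \<otimes> h) = \<pi> g * \<pi> h" if gh: "g \<in> carrier G" "h \<in> carrier G" for g h
  proof (rule eq_matI)
    fix i j assume "i < dim_row (\<pi> g * \<pi> h)" "j < dim_col (\<pi> g * \<pi> h)"
    then have ij: "i < m" "j < m" by (auto simp: \<pi>_def)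
    \<comment> \<open>\<open>h\<close> moves coset \<open>j\<close> to coset \<open>k\<close>, so
      only \<open>l = k\<close> contributes to the entry of the product.\<close>
    obtain k where k: "k < m" "e k = h <# e j" using e_surj act[OF gh(2) e_in[OF ij(2)]] by blast
    have gk: "g <# e k = (g \<otimes> h) <# e j"
      unfolding k(2) using lcos_m_assoc[OF _ gh] rcosets_carrier[OF group_axioms e_in[OF ij(2)]] by blast
    have "(\<pi> g * \<pi> h) $$ (i, j) = (\<Sum>l<m. \<pi> g $$ (i, l) * \<pi> h $$ (l, j))"
      by (rule index_mult_mat_sum[OF \<pi>c \<pi>c ij])
    also have "\<dots> = (\<Sum>l<m. if l = k then \<pi> g $$ (i, k) else 0)"
      using ij k e_inj by (intro sum.cong refl) (auto simp: \<pi>_def k(2)[symmetric])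
    also have "\<dots> = \<pi> g $$ (i, k)" using k by simp
    also have "\<dots> = \<pi> (g \<otimes> h) $$ (i, j)" using ij k(1) gk by (simp add: \<pi>_def)
    finally show "\<pi> (g \<otimes> h) $$ (i, j) = (\<pi> g * \<pi> h) $$ (i, j)" by simp
  qed (auto simp: \<pi>_def)
  then have "matrix_rep G m \<pi>" unfolding matrix_rep_def using \<pi>c one by simp
  moreover have "mat_trace (\<pi> g) = (if g \<in> H then of_nat m else 0)" if g: "g \<in> carrier G" for g
  proof -
    have "mat_trace (\<pi> g) = (\<Sum>i<m. if g \<in> H then 1 else 0)"
      unfolding mat_trace_def using lcos_rcos_fixed_iff[OF g e_in]
      by (intro sum.cong) (auto simp: \<pi>_def)
    then show ?thesis by simp
  qed
  ultimately show ?thesis using that one by blast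
qed

text \<open>The permutation character of \<open>G\<close> on the cosets of \<open>H\<close> contains each irreducible
  character \<open>\<psi>\<close> with \<open>H\<close> in its kernel exactly \<open>\<psi>(1)\<close> times, and no others.\<close>

lemma X_ker_regular_character:
  assumes fin: "finite (carrier G)"
  shows "finite (X_ker G H)"
    and "g \<in> carrier G \<Longrightarrow> g \<notin> H \<Longrightarrow> (\<Sum>\<psi>\<in>X_ker G H. \<psi> \<one> * \<psi> g) = 0"
proof -
  define m where "m = card (rcosets H)"
  obtain \<pi> where \<pi>: "matrix_rep G m \<pi>" "\<And>x. x \<in> H \<Longrightarrow> \<pi> x = 1\<^sub>m m"
    "\<And>g. g \<in> carrier G \<Longrightarrow> mat_trace (\<pi> g) = (if g \<in> H then of_nat m else 0)"
    unfolding m_def by (rule coset_permutation_rep[OF fin]) blast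
  obtain \<psi>s where \<psi>s: "set \<psi>s \<subseteq> Irr G" "\<forall>g\<in>carrier G. mat_trace (\<pi> g) = (\<Sum>\<psi>\<leftarrow>\<psi>s. \<psi> g)"
    "\<forall>\<psi>\<in>set \<psi>s. {g \<in> carrier G. \<pi> g = 1\<^sub>m m} \<subseteq> char_ker G \<psi>"
    using trace_composition_factors[OF group_axioms \<pi>(1)] by blast
  have sum_list: "(\<Sum>\<psi>\<leftarrow>xs. f \<psi>) = (\<Sum>\<psi>\<in>set xs. of_nat (count_list xs \<psi>) * f \<psi>)"
    for f :: "('a \<Rightarrow> complex) \<Rightarrow> complex" and xs
    by (rule sum_list_map_eq_sum_of_nat_count) auto
  have sub: "set \<psi>s \<subseteq> X_ker G H"
  proof
    fix \<psi> assume \<psi>: "\<psi> \<in> set \<psi>s"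
    have "H \<subseteq> {g \<in> carrier G. \<pi> g = 1\<^sub>m m}" using \<pi>(2) subset by auto
    then show "\<psi> \<in> X_ker G H" using \<psi> \<psi>s unfolding X_ker_def by blast
  qed
  have order: "card H * m = card (carrier G)"
    using lagrange_finite[OF fin subgroup_axioms] by (simp add: m_def Coset.order_def mult.commute)
  have cG: "card (carrier G) > 0" using fin card_gt_0_iff one_closed by blast
  \<comment> \<open>The pairing of the permutation character with \<open>\<phi>\<close> is computed
    twice. Directly, only \<open>H\<close> contributes, and Lagrange's theorem gives the group order
    times the degree of \<open>\<phi>\<close>. By orthogonality it is the group order times the
    multiplicity.\<close>
  have count: "of_nat (count_list \<psi>s \<phi>) = \<phi> \<one>" if \<phi>: "\<phi> \<in> X_ker G H" for \<phi>
  proof -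
    have \<phi>I: "\<phi> \<in> Irr G" and \<phi>H: "\<And>x. x \<in> H \<Longrightarrow> \<phi> x = \<phi> \<one>"
      using \<phi> by (auto simp: X_ker_def char_ker_def)
    have "(\<Sum>g\<in>carrier G. mat_trace (\<pi> g) * \<phi> (inv g)) =
        (\<Sum>g\<in>carrier G. if g \<in> H then of_nat m * \<phi> \<one> else 0)"
    proof (rule sum.cong[OF refl])
      fix g assume g: "g \<in> carrier G"
      show "mat_trace (\<pi> g) * \<phi> (inv g) = (if g \<in> H then of_nat m * \<phi> \<one> else 0)"
      proof (cases "g \<in> H")
        case True
        then have "\<phi> (inv g) = \<phi> \<one>" by (intro \<phi>H m_inv_closed)
        then show ?thesis using \<pi>(3)[OF g] True by simp
      qed (use \<pi>(3)[OF g] in simp)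
    qed
    also have "\<dots> = (\<Sum>g\<in>H. of_nat m * \<phi> \<one>)"
      using fin subset by (simp add: sum.If_cases Int_absorb1)
    also have "\<dots> = of_nat (card (carrier G)) * \<phi> \<one>"
      by (simp flip: order)
    finally have 1: "(\<Sum>g\<in>carrier G. mat_trace (\<pi> g) * \<phi> (inv g)) = of_nat (card (carrier G)) * \<phi> \<one>" .
    have "(\<Sum>g\<in>carrier G. mat_trace (\<pi> g) * \<phi> (inv g)) =
        (\<Sum>g\<in>carrier G. \<Sum>\<psi>\<in>set \<psi>s. of_nat (count_list \<psi>s \<psi>) * (\<psi> g * \<phi> (inv g)))"
      using \<psi>s(2) by (intro sum.cong refl) (simp add: sum_list sum_distrib_right mult.assoc)
    also have "\<dots> = (\<Sum>\<psi>\<in>set \<psi>s. of_nat (count_list \<psi>s \<psi>) * (\<Sum>g\<in>carrier G. \<psi> g * \<phi> (inv g)))"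
      unfolding sum_distrib_left by (rule sum.swap)
    also have "\<dots> = (\<Sum>\<psi>\<in>set \<psi>s. if \<psi> = \<phi> then of_nat (count_list \<psi>s \<phi>) * of_nat (card (carrier G)) else 0)"
      using \<psi>s(1) by (intro sum.cong refl) (auto simp: Irr_orthogonality[OF _ \<phi>I] subset_iff)
    also have "\<dots> = of_nat (count_list \<psi>s \<phi>) * of_nat (card (carrier G))"
      by (auto simp: count_list_0_iff)
    finally show ?thesis using 1 cG by simp
  qed
  \<comment> \<open>Degrees are positive, so every character in \<open>X_ker G H\<close> has nonzero
    multiplicity and occurs in the finite list.\<close>
  have set_eq: "set \<psi>s = X_ker G H"
  proof (intro equalityI sub subsetI)
    fix \<phi> assume \<phi>: "\<phi> \<in> X_ker G H"
    then have "\<phi> \<in> Irr G" by (simp add: X_ker_def)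
    then obtain n where "\<phi> \<one> = of_nat n" "n > 0" using Irr_cases[OF group_axioms] by metis
    then have "count_list \<psi>s \<phi> \<noteq> 0" using count[OF \<phi>] by auto
    then show "\<phi> \<in> set \<psi>s" using count_notin by fastforce
  qed
  then show "finite (X_ker G H)" using finite_set[of \<psi>s] by simp
  show "(\<Sum>\<psi>\<in>X_ker G H. \<psi> \<one> * \<psi> g) = 0" if g: "g \<in> carrier G" "g \<notin> H"
  proof -
    have "(\<Sum>\<psi>\<in>X_ker G H. \<psi> \<one> * \<psi> g) = (\<Sum>\<psi>\<in>set \<psi>s. of_nat (count_list \<psi>s \<psi>) * \<psi> g)"
      using count set_eq by simp
    also have "\<dots> = mat_trace (\<pi> g)" using \<psi>s(2) g by (simp add: sum_list)
    finally show ?thesis using \<pi>(3) g by simp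
  qed
qed

end

subsection \<open>Partition of the characters by the largest subgroup in the kernel\<close>

context group
begin

text \<open>On a normal subgroup inside the kernel of the character the representation itself is
  trivial, so it is also trivial on products of elements of two such subgroups.\<close>

lemma set_mult_subset_char_ker:
  assumes fin: "finite (carrier G)" and \<psi>: "\<psi> \<in> Irr G" and N: "N \<lhd> G" "N \<subseteq> char_ker G \<psi>"
    and H: "H \<lhd> G" "H \<subseteq> char_ker G \<psi>"
  shows "N <#> H \<subseteq> char_ker G \<psi>"
proof
  fix z assume "z \<in> N <#> H"
  then obtain x y where z: "x \<in> N" "y \<in> H" "z = x \<otimes> y" by (auto simp: set_mult_def)
  obtain n \<rho> where \<rho>: "irreducible_rep G n \<rho>" "\<And>g. g \<in> carrier G \<Longrightarrow> \<psi> g = mat_trace (\<rho> g)"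
    "\<psi> \<one> = of_nat n"
    using Irr_cases[OF group_axioms \<psi>] by metis
  note R = irreducible_repD(1)[OF group_axioms \<rho>(1)]
  have triv: "\<rho> x = 1\<^sub>m n" if "K \<lhd> G" "K \<subseteq> char_ker G \<psi>" "x \<in> K" for K x
  proof (rule normal_char_ker_rep_trivial[OF fin \<rho>(1) that(1) _ that(3)])
    fix y assume "y \<in> K"
    then have "y \<in> carrier G" "\<psi> y = \<psi> \<one>" using that(2) by (auto simp: char_ker_def)
    then show "mat_trace (\<rho> y) = of_nat n" using \<rho> by simp
  qed
  have c: "x \<in> carrier G" "y \<in> carrier G" using z N H by (auto simp: char_ker_def)
  have "\<rho> z = 1\<^sub>m n"
    using matrix_repD(2)[OF R c] triv[OF N z(1)] triv[OF H z(2)] z(3) by simp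
  then show "z \<in> char_ker G \<psi>" using z(3) c \<rho> by (simp add: char_ker_def)
qed

lemma AS_normal:
  assumes "S \<subseteq> normal_subgroups G" "N \<in> AS G S"
  shows "N \<lhd> G"
  using assms(2)
proof induction
  case AS_trivial
  show ?case by (rule one_is_normal)
next
  case AS_carrier
  show ?case by (simp add: normal_inv_iff subgroup_self)
next
  case (AS_base N)
  then show ?case using assms(1) by (auto simp: normal_subgroups_def)
next
  case (AS_prod N H)
  then show ?case by (intro normal_subgroup_set_mult_closed)
next
  case (AS_inter N H)
  then show ?case by (intro normal_subgroup_intersect)
qed

text \<open>Among the finitely many members of \<open>AS G S\<close> between \<open>N\<close> and
  the kernel of \<open>\<psi>\<close> there is a maximal one, and \<open>\<psi>\<close> belongs to
  its piece.\<close>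

lemma X_ker_eq_Union_X_bullet:
  assumes fin: "finite (carrier G)" and N: "N \<in> AS G S"
  shows "X_ker G N = (\<Union>K\<in>{K \<in> AS G S. N \<subseteq> K}. X_bullet G S K)"
proof (intro equalityI subsetI)
  fix \<psi> assume \<psi>: "\<psi> \<in> X_ker G N"
  define F where "F = {K \<in> AS G S. N \<subseteq> K \<and> K \<subseteq> char_ker G \<psi>}"
  have "F \<subseteq> Pow (carrier G)" by (auto simp: F_def char_ker_def)
  then have "finite F" using fin finite_subset by blast
  moreover have "N \<in> F" using N \<psi> by (simp add: F_def X_ker_def)
  \<comment> \<open>A member of \<open>AS G S\<close> that strictly contains \<open>K\<close> and
    lies in the kernel would contain \<open>N\<close> as well, hence belong to
    \<open>F\<close>.\<close>
  ultimately obtain K where K: "K \<in> F" "\<And>L. L \<in> F \<Longrightarrow> K \<subseteq> L \<Longrightarrow> L = K"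
    using finite_has_maximal2[of F N] by metis
  then have "\<psi> \<in> X_bullet G S K" using \<psi> unfolding X_bullet_def X_ker_def F_def by blast
  then show "\<psi> \<in> (\<Union>K\<in>{K \<in> AS G S. N \<subseteq> K}. X_bullet G S K)" using K(1) by (auto simp: F_def)
next
  fix \<psi> assume "\<psi> \<in> (\<Union>K\<in>{K \<in> AS G S. N \<subseteq> K}. X_bullet G S K)"
  then show "\<psi> \<in> X_ker G N" by (auto simp: X_bullet_def X_ker_def)
qed

text \<open>For a common \<open>\<psi>\<close> the product \<open>K <#> L\<close> lies in
  \<open>AS G S\<close> and in the kernel, and it contains both factors. Neither inclusion can be
  strict by the definition of \<open>X_bullet\<close>, so both factors equal the product.\<close>

lemma X_bullet_disjoint:
  assumes fin: "finite (carrier G)" and S: "S \<subseteq> normal_subgroups G"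
    and K: "K \<in> AS G S" and L: "L \<in> AS G S" and ne: "K \<noteq> L"
  shows "X_bullet G S K \<inter> X_bullet G S L = {}"
proof (rule ccontr)
  assume "X_bullet G S K \<inter> X_bullet G S L \<noteq> {}"
  then obtain \<psi> where \<psi>: "\<psi> \<in> X_bullet G S K" "\<psi> \<in> X_bullet G S L" by blast
  then have I: "\<psi> \<in> Irr G" "K \<subseteq> char_ker G \<psi>" "L \<subseteq> char_ker G \<psi>"
    by (auto simp: X_bullet_def X_ker_def)
  note nK = AS_normal[OF S K] and nL = AS_normal[OF S L]
  interpret K: normal K G by (rule nK)
  interpret L: normal L G by (rule nL)
  have "K <#> L \<subseteq> char_ker G \<psi>" by (rule set_mult_subset_char_ker[OF fin I(1) nK I(2) nL I(3)])
  then have KL: "\<psi> \<in> X_ker G (K <#> L)" "K <#> L \<in> AS G S"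
    using I(1) AS_prod[OF K L] by (auto simp: X_ker_def)
  have "K \<subseteq> K <#> L"
  proof
    fix x assume x: "x \<in> K"
    then have "x = x \<otimes> \<one>" using K.mem_carrier by simp
    then show "x \<in> K <#> L" using x L.one_closed unfolding set_mult_def by blast
  qed
  moreover have "L \<subseteq> K <#> L"
  proof
    fix x assume x: "x \<in> L"
    then have "x = \<one> \<otimes> x" using L.mem_carrier by simp
    then show "x \<in> K <#> L" using x K.one_closed unfolding set_mult_def by blast
  qed
  moreover have "\<not> M \<subset> K <#> L" if "\<psi> \<in> X_bullet G S M" for M
    using that KL unfolding X_bullet_def by blast
  ultimately have "K = K <#> L" "L = K <#> L" using \<psi> by (metis psubsetI)+
  with ne show False by simp
qed

lemma sum_chi_bullet_eq_0:
  assumes fin: "finite (carrier G)" and S: "S \<subseteq> normal_subgroups G"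
    and N: "N \<in> AS G S" and g: "g \<in> carrier G" "g \<notin> N"
  shows "(\<Sum>K\<in>{K \<in> AS G S. N \<subseteq> K}. chi_bullet G S K g) = 0"
proof -
  let ?A = "{K \<in> AS G S. N \<subseteq> K}"
  interpret N: normal N G by (rule AS_normal[OF S N])
  have "?A \<subseteq> Pow (carrier G)"
    using AS_normal[OF S] normal_imp_subgroup subgroup.subset by blast
  then have finA: "finite ?A" using fin finite_subset by blast
  \<comment> \<open>Each piece lies in the finite set \<open>X_ker G N\<close>; summing over the
    disjoint union requires finite pieces.\<close>
  have "finite (X_bullet G S K)" if "K \<in> ?A" for K
    using finite_subset[OF _ N.X_ker_regular_character(1)[OF fin]] that
    X_ker_eq_Union_X_bullet[OF fin N] by blast
  then have "(\<Sum>\<psi>\<in>(\<Union>K\<in>?A. X_bullet G S K). \<psi> \<one> * \<psi> g) = (\<Sum>K\<in>?A. chi_bullet G S K g)"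
    unfolding chi_bullet_def using finA X_bullet_disjoint[OF fin S]
    by (intro sum.UNION_disjoint) auto
  then show ?thesis
    using N.X_ker_regular_character(2)[OF fin g] X_ker_eq_Union_X_bullet[OF fin N] by simp
qed

end

section \<open>Values of the bullet character inside and outside \<open>N\<close>\<close>

theorem theorem3p5:
  fixes G :: "('a, 'b) monoid_scheme" (structure)
    and S :: "'a set set" and N :: "'a set" and g :: 'a
  assumes "group G" and "finite (carrier G)"
    and "S \<subseteq> normal_subgroups G"
    and "N \<in> AS G S" and "g \<in> carrier G"
  shows "chi_bullet G S N g =
    (if g \<in> N then (\<Sum>\<psi>\<in>X_bullet G S N. (\<psi> \<one>)\<^sup>2)
     else - (\<Sum>K\<in>{K \<in> AS G S. N \<subset> K}. chi_bullet G S K g))"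
proof (cases "g \<in> N")
  case True
  then have "\<psi> g = \<psi> \<one>" if "\<psi> \<in> X_bullet G S N" for \<psi>
    using that by (auto simp: X_bullet_def X_ker_def char_ker_def)
  then show ?thesis using True by (auto simp: chi_bullet_def power2_eq_square intro!: sum.cong)
next
  case False
  interpret group G by fact
  let ?B = "{K \<in> AS G S. N \<subset> K}"
  have "?B \<subseteq> Pow (carrier G)"
    using AS_normal[OF assms(3)] normal_imp_subgroup subgroup.subset by blast
  then have "finite ?B" using assms(2) finite_subset by blast
  \<comment> \<open>The term for \<open>K = N\<close> is split off from the vanishing sum; what
    remains runs over the strictly larger members.\<close>
  moreover have "{K \<in> AS G S. N \<subseteq> K} = insert N ?B" using assms(4) by auto
  ultimately have "chi_bullet G S N g + (\<Sum>K\<in>?B. chi_bullet G S K g) = 0"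
    using sum_chi_bullet_eq_0[OF assms(2-5) False] by simp
  then show ?thesis using False by (simp add: eq_neg_iff_add_eq_0)
qed

end
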